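(* Suppose $M$ is a finite irreducible projection monoid on $\mathbb{R}^3$. Then $M$ or its dual $M^*$ is equivalent to a submonoid of $\mathcal{A}_3$ or of $\mathcal{B}_3^2$ (both taken over the field $\mathbb{R}$).
   Context: A projection on a finite-dimensional vector space $V$ over a field is an idempotent linear map $V\to V$ whose kernel has dimension $1$ (so its image has codimension $1$). A projection monoid on $V$ is a submonoid of $\operatorname{End}(V)$ generated by projections. It is irreducible if there is no subspace $0<W<V$ mapped into itself by all elements of $M$. Monoids $M$ of endomorphisms of $V$ and $N$ of endomorphisms of $W$ are equivalent if there is a bijective linear map $f:V\to W$ with $N=\{fmf^{-1}: m\in M\}$. The dual of $M$ is the projection monoid $M^*=\{m^*:m\in M\}$ on the dual space $V^*$, where $m^*$ is the dual map of $m$. The monoid $\mathcal{A}_3$ (over $\mathbb R$): let $V^+$ be a real vector space with basis $e_0,e_1,e_2,e_3$ and let $V$ be the $3$-dimensional subspace spanned by all $e_i-e_j$. For $i\neq j$ in $\{0,1,2,3\}$ let $p_{ij}:V\to V$ be the projection with kernel $\langle e_i-e_j\rangle$ and image $\langle e_k-e_l : k,l\neq i\rangle$. Then $\mathcal{A}_3$ is the monoid generated by all the $p_{ij}$. The monoid $\mathcal{B}_3^2$ (over $\mathbb R$): let $V$ be a real vector space with basis $e_1,e_2,e_3$ and let $Z=\{1,-1\}$. For $i\in\{1,2,3\}$ let $p_i$ be the projection with kernel $\langle e_i\rangle$ and image $\langle e_k: k\ne i\rangle$; for $i\ne j$ and $z\in Z$ let $p_{ij}^z$ be the projection with kernel $\langle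 e_i-ze_j\rangle$ and image $\langle e_k:k\neq i\rangle$. Then $\mathcal{B}_3^2$ is the monoid generated by all the $p_i$ and $p_{ij}^z$. *)

theory Defs
  imports "HOL-Analysis.Analysis" "HOL-Algebra.Group"
begin

text \<open>
  A vector space is a subspace \<open>V\<close> of some type of class \<open>real_vector\<close>. Linear maps on \<open>V\<close> are
  functions that are \<^const>\<open>undefined\<close> outside \<open>V\<close>, so that equality of functions is equality
  of maps on \<open>V\<close>. For \<open>V = UNIV\<close> this is no restriction.
\<close>

definition fin_dim_space :: "'a::real_vector set \<Rightarrow> bool" where
  "fin_dim_space V \<longleftrightarrow> (\<exists>B. finite B \<and> V = span B)"

definition linear_between :: "'a::real_vector set \<Rightarrow> 'b::real_vector set \<Rightarrow> ('a \<Rightarrow> 'b) \<Rightarrow> bool" where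
  "linear_between V W f \<longleftrightarrow>
     f \<in> V \<rightarrow> W \<and>
     (\<forall>x\<in>V. \<forall>y\<in>V. f (x + y) = f x + f y) \<and>
     (\<forall>c. \<forall>x\<in>V. f (c *\<^sub>R x) = c *\<^sub>R f x)"

definition End_monoid :: "'a::real_vector set \<Rightarrow> ('a \<Rightarrow> 'a) monoid" where
  "End_monoid V =
     \<lparr>carrier = {m \<in> extensional V. linear_between V V m},
      monoid.mult = compose V,
      one = (\<lambda>x\<in>V. x)\<rparr>"

definition kernel_on :: "'a::real_vector set \<Rightarrow> ('a \<Rightarrow> 'a) \<Rightarrow> 'a set" where
  "kernel_on V m = {x \<in> V. m x = 0}"

definition is_projection :: "'a::real_vector set \<Rightarrow> ('a \<Rightarrow> 'a) \<Rightarrow> bool" where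
  "is_projection V p \<longleftrightarrow>
     p \<in> carrier (End_monoid V) \<and> compose V p p = p \<and> dim (kernel_on V p) = 1"

inductive_set generated_monoid :: "'a::real_vector set \<Rightarrow> ('a \<Rightarrow> 'a) set \<Rightarrow> ('a \<Rightarrow> 'a) set"
  for V P where
  one: "\<one>\<^bsub>End_monoid V\<^esub> \<in> generated_monoid V P"
| gen: "p \<in> P \<Longrightarrow> p \<in> generated_monoid V P"
| mult: "m \<in> generated_monoid V P \<Longrightarrow> n \<in> generated_monoid V P \<Longrightarrow>
         m \<otimes>\<^bsub>End_monoid V\<^esub> n \<in> generated_monoid V P"

definition projection_monoid :: "'a::real_vector set \<Rightarrow> ('a \<Rightarrow> 'a) set \<Rightarrow> bool" where
  "projection_monoid V M \<longleftrightarrow>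
     fin_dim_space V \<and> (\<exists>P. (\<forall>p\<in>P. is_projection V p) \<and> M = generated_monoid V P)"

definition irreducible_monoid :: "'a::real_vector set \<Rightarrow> ('a \<Rightarrow> 'a) set \<Rightarrow> bool" where
  "irreducible_monoid V M \<longleftrightarrow>
     \<not> (\<exists>W. subspace W \<and> {0} \<subset> W \<and> W \<subset> V \<and> (\<forall>m\<in>M. m ` W \<subseteq> W))"

definition equivalent_monoids ::
  "'a::real_vector set \<Rightarrow> ('a \<Rightarrow> 'a) set \<Rightarrow> 'b::real_vector set \<Rightarrow> ('b \<Rightarrow> 'b) set \<Rightarrow> bool" where
  "equivalent_monoids V M W N \<longleftrightarrow>
     (\<exists>f. linear_between V W f \<and> bij_betw f V W \<and>
          N = (\<lambda>m. \<lambda>y\<in>W. f (m (inv_into V f y))) ` M)"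

text \<open>
  The monoid \<open>A\<close> is given by its underlying set; its operations are those of \<open>End_monoid W\<close>, so
  its submonoids are the submonoids of \<open>End_monoid W\<close> contained in \<open>A\<close>.
\<close>

definition equivalent_to_submonoid ::
  "'a::real_vector set \<Rightarrow> ('a \<Rightarrow> 'a) set \<Rightarrow> 'b::real_vector set \<Rightarrow> ('b \<Rightarrow> 'b) set \<Rightarrow> bool" where
  "equivalent_to_submonoid V M W A \<longleftrightarrow>
     (\<exists>N. submonoid N (End_monoid W) \<and> N \<subseteq> A \<and> equivalent_monoids V M W N)"

text \<open>
  The dual space of a Euclidean space \<open>'a\<close> is the type \<open>'a \<Rightarrow>\<^sub>L real\<close>; in finite dimension every
  linear functional is bounded. \<open>Blinfun\<close> is meaningful in \<open>dual_map m\<close> because \<open>m\<close> is linear.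
\<close>

definition dual_map :: "('a::euclidean_space \<Rightarrow> 'a) \<Rightarrow> ('a \<Rightarrow>\<^sub>L real) \<Rightarrow> ('a \<Rightarrow>\<^sub>L real)" where
  "dual_map m = (\<lambda>\<phi>. Blinfun (\<lambda>x. blinfun_apply \<phi> (m x)))"

definition dual_monoid ::
  "('a::euclidean_space \<Rightarrow> 'a) set \<Rightarrow> (('a \<Rightarrow>\<^sub>L real) \<Rightarrow> ('a \<Rightarrow>\<^sub>L real)) set" where
  "dual_monoid M = dual_map ` M"

text \<open>A projection is determined by its kernel and image.\<close>

definition projection_along ::
  "'a::real_vector set \<Rightarrow> 'a set \<Rightarrow> 'a set \<Rightarrow> ('a \<Rightarrow> 'a) \<Rightarrow> bool" where
  "projection_along V K U p \<longleftrightarrow> is_projection V p \<and> kernel_on V p = K \<and> p ` V = U"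

abbreviation basis_vec :: "'n::finite \<Rightarrow> real ^ 'n" where
  "basis_vec i \<equiv> axis i 1"

text \<open>The index type \<open>4\<close> consists of \<open>0, 1, 2, 3\<close>.\<close>

definition A3_space :: "(real ^ 4) set" where
  "A3_space = span {basis_vec i - basis_vec j | i j. True}"

definition A3_generators :: "(real ^ 4 \<Rightarrow> real ^ 4) set" where
  "A3_generators =
     {p. \<exists>i j. i \<noteq> j \<and>
        projection_along A3_space
          (span {basis_vec i - basis_vec j})
          (span {basis_vec k - basis_vec l | k l. k \<noteq> i \<and> l \<noteq> i}) p}"

definition A3_monoid :: "(real ^ 4 \<Rightarrow> real ^ 4) set" where
  "A3_monoid = generated_monoid A3_space A3_generators"

text \<open>The index type \<open>3\<close> consists of \<open>1, 2\<close> and \<open>3 = 0\<close>.\<close>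

definition B32_generators :: "(real ^ 3 \<Rightarrow> real ^ 3) set" where
  "B32_generators =
     {p. \<exists>i. projection_along UNIV
          (span {basis_vec i}) (span {basis_vec k | k. k \<noteq> i}) p} \<union>
     {p. \<exists>i j. \<exists>z \<in> {1, -1 :: real}. i \<noteq> j \<and>
        projection_along UNIV
          (span {basis_vec i - z *\<^sub>R basis_vec j}) (span {basis_vec k | k. k \<noteq> i}) p}"

definition B32_monoid :: "(real ^ 3 \<Rightarrow> real ^ 3) set" where
  "B32_monoid = generated_monoid UNIV B32_generators"

end

theory Submission
  imports Defs
begin

text \<open>
  A projection is \<open>x \<mapsto> x - (\<phi> \<bullet> x) v\<close> with \<open>\<phi> \<bullet> v = 1\<close>, and its cofactor map is the rank one map
  \<open>x \<mapsto> (v \<bullet> x) \<phi>\<close>. The cofactor maps of the elements of \<open>M\<close> form a finite monoid; by irreducibility it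
  links any two generators, which forces a normalisation of the vectors \<open>v\<close> and functionals \<open>\<phi>\<close> with
  all \<open>\<phi> \<bullet> v \<in> {-1, 0, 1}\<close>. Passing to idempotent powers shows moreover that \<open>M\<close> contains the projection
  along \<open>v\<close> onto \<open>ker \<phi>\<close> for every pair with \<open>\<phi> \<bullet> v \<noteq> 0\<close>. So the problem is one about the matrix
  \<open>(\<phi> \<bullet> v)\<close> of rank three: two small patterns of nonzero entries yield elements of infinite order, and
  without them either every column or every row has at most two nonzero entries up to sign. In the
  first case the matrix is the incidence matrix of a connected signed graph, which is unbalanced on
  three vertices (type \<open>B\<close>) or balanced on four vertices (type \<open>A\<close>); the second case is dual.
\<close>

section \<open>Projections and cofactor maps\<close>

text \<open>A product of projections exposes no scalar, whereas
  \<open>rank_one v \<phi> \<circ> rank_one w \<psi>\<close> is \<open>v \<bullet> \<psi>\<close>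
  times \<open>rank_one w \<phi>\<close>. On second exterior powers finiteness therefore speaks
  directly about matrix entries. The obstacle is that a projection fixes its vector and its
  functional only up to inverse scalars, so entries between different generators have no meaning at
  first. Linking everything to one fixed generator \<open>(a, \<alpha>)\<close> selects
  representatives up to sign, which is why rows and columns are compared by \<open>par\<close>. With
  entries 1 and -1, a two by two block of nonzero entries has determinant 0 or \<plusminus>2. For
  rows and columns that are not parallel, determinant 0 produces a shear; the other excluded pattern
  is the hook, where some word has eigenvalue \<plusminus>2. The surviving blocks contain an odd
  number of entries -1, and this parity drives the combinatorics.\<close>

definition elem_proj :: "real ^ 3 \<Rightarrow> real ^ 3 \<Rightarrow> real ^ 3 \<Rightarrow> real ^ 3" where
  "elem_proj v \<phi> x = x - ((\<phi> \<bullet> x) / (\<phi> \<bullet> v)) *\<^sub>R v"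

definition rank_one :: "real ^ 3 \<Rightarrow> real ^ 3 \<Rightarrow> real ^ 3 \<Rightarrow> real ^ 3" where
  "rank_one v \<phi> x = (v \<bullet> x) *\<^sub>R \<phi>"

text \<open>For linear \<open>m\<close> this is the second exterior power of \<open>m\<close>,
  carried to vectors by the cross product; its matrix is the cofactor matrix of
  \<open>m\<close>.\<close>

definition cofactor :: "(real ^ 3 \<Rightarrow> real ^ 3) \<Rightarrow> real ^ 3 \<Rightarrow> real ^ 3" where
  "cofactor m x =
     x $ 1 *\<^sub>R cross3 (m (axis 2 1)) (m (axis 3 1)) +
     x $ 2 *\<^sub>R cross3 (m (axis 3 1)) (m (axis 1 1)) +
     x $ 3 *\<^sub>R cross3 (m (axis 1 1)) (m (axis 2 1))"

lemma linear_elem_proj: "linear (elem_proj v \<phi>)"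
  by (rule linearI) (simp_all add: elem_proj_def inner_add_right add_divide_distrib algebra_simps)

text \<open>The division in \<open>elem_proj\<close> makes the projection depend only on two lines,
  so representatives can be rescaled later without changing it.\<close>

lemma elem_proj_scale:
  assumes "a \<noteq> 0" "b \<noteq> 0"
  shows "elem_proj (a *\<^sub>R v) (b *\<^sub>R \<phi>) = elem_proj v \<phi>"
  using assms by (auto simp: elem_proj_def fun_eq_iff)

lemma elem_proj_fixes: "\<phi> \<bullet> x = 0 \<Longrightarrow> elem_proj v \<phi> x = x"
  by (simp add: elem_proj_def)

lemma vec3_decompose: "(x::real ^ 3) = x $ 1 *\<^sub>R axis 1 1 + x $ 2 *\<^sub>R axis 2 1 + x $ 3 *\<^sub>R axis 3 1"
  by (simp add: vec_eq_iff forall_3 axis_def)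

lemma cofactor_cross3:
  assumes "linear m"
  shows "cofactor m (cross3 a b) = cross3 (m a) (m b)"
proof -
  have m: "m x = x $ 1 *\<^sub>R m (axis 1 1) + x $ 2 *\<^sub>R m (axis 2 1) + x $ 3 *\<^sub>R m (axis 3 1)" for x
    by (subst vec3_decompose[of x]) (simp only: linear_add[OF assms] linear_scale[OF assms])
  show ?thesis
    unfolding m[of a] m[of b] cofactor_def cross3_def vec_eq_iff forall_3
    by (simp add: vector_3; intro conjI; algebra)
qed

lemma linear_cofactor: "linear (cofactor m)"
  by (rule linearI) (simp_all add: cofactor_def algebra_simps)

lemma cofactor_comp:
  assumes "linear m" "linear n"
  shows "cofactor (m \<circ> n) = cofactor m \<circ> cofactor n"
proof
  fix x
  note lc = linear_cofactor[of m]
  show "cofactor (m \<circ> n) x = (cofactor m \<circ> cofactor n) x"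
    by (simp add: cofactor_def[of "m \<circ> n"] cofactor_def[of n] linear_add[OF lc] linear_scale[OF lc]
        cofactor_cross3[OF assms(1)])
qed

lemma cofactor_elem_proj:
  assumes "\<phi> \<bullet> v = 1"
  shows "cofactor (elem_proj v \<phi>) = rank_one v \<phi>"
proof
  fix x
  have 1: "\<phi> $ 1 * v $ 1 = 1 - \<phi> $ 2 * v $ 2 - \<phi> $ 3 * v $ 3"
    using assms by (simp add: inner_vec_def sum_3)
  have e: "elem_proj v \<phi> y = y - (\<phi> \<bullet> y) *\<^sub>R v" for y
    by (simp add: elem_proj_def assms)
  have k: "cross3 (a - (\<phi> \<bullet> a) *\<^sub>R v) (b - (\<phi> \<bullet> b) *\<^sub>R v) =
      cross3 a b - (\<phi> \<bullet> a) *\<^sub>R cross3 v b + (\<phi> \<bullet> b) *\<^sub>R cross3 v a" for a b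
    unfolding cross3_def vec_eq_iff forall_3 by (simp add: vector_3; intro conjI; algebra)
  \<comment> \<open>Contraction of the trivector of v, a, b by \<phi>: term by term on the left, as
    the determinant times the contracted volume form on the right.\<close>
  have k2: "(\<phi> \<bullet> v) *\<^sub>R cross3 a b - (\<phi> \<bullet> a) *\<^sub>R cross3 v b + (\<phi> \<bullet> b) *\<^sub>R cross3 v a =
      (v \<bullet> cross3 a b) *\<^sub>R \<phi>" for a b
    unfolding cross3_def vec_eq_iff forall_3 inner_vec_def sum_3
    by (simp add: vector_3; intro conjI; algebra)
  have k3: "cross3 (elem_proj v \<phi> a) (elem_proj v \<phi> b) = (v \<bullet> cross3 a b) *\<^sub>R \<phi>" for a b
    unfolding e k using k2[of a b] assms by simp
  have ax: "cross3 (axis 2 1) (axis 3 1) = axis 1 1" "cross3 (axis 3 1) (axis 1 1) = axis 2 1"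
    "cross3 (axis 1 1) (axis 2 1) = axis 3 1"
    by (simp_all add: cross3_def vec_eq_iff forall_3 axis_def vector_3)
  show "cofactor (elem_proj v \<phi>) x = rank_one v \<phi> x"
    unfolding cofactor_def k3 ax rank_one_def
    by (simp add: inner_axis inner_vec_def[of v x] sum_3 algebra_simps)
qed

lemma rank_one_comp: "rank_one v \<phi> \<circ> rank_one w \<psi> = rank_one w ((v \<bullet> \<psi>) *\<^sub>R \<phi>)"
  by (simp add: rank_one_def fun_eq_iff)

lemma rank_one_scale: "rank_one (c *\<^sub>R v) \<phi> = rank_one v (c *\<^sub>R \<phi>)"
  by (simp add: rank_one_def fun_eq_iff)

lemma rank_one_inj:
  assumes "rank_one v \<phi> = rank_one v \<psi>" "v \<noteq> 0"
  shows "\<phi> = \<psi>"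
proof -
  have "rank_one v \<phi> v = rank_one v \<psi> v" using assms by simp
  then have "(v \<bullet> v) *\<^sub>R \<phi> = (v \<bullet> v) *\<^sub>R \<psi>" by (simp only: rank_one_def)
  then show ?thesis using assms(2) by simp
qed

lemma cross3_parallel:
  assumes "v \<noteq> 0" "cross3 v z = 0"
  obtains c where "z = c *\<^sub>R v"
proof -
  have "z = 0 \<or> (\<exists>c. z = c *\<^sub>R v)"
    using assms unfolding cross_eq_0 collinear_lemma by simp
  then show ?thesis using that by (metis scale_zero_left)
qed

text \<open>The cofactor map of a map of rank two determines its kernel and its image.\<close>

lemma idempotent_cofactor_rank_one:
  assumes lin: "linear e" and idem: "e \<circ> e = e"
    and cof: "cofactor e = rank_one v \<phi>" and nz: "\<phi> \<bullet> v \<noteq> 0"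
  shows "e = elem_proj v \<phi>"
proof -
  have v: "v \<noteq> 0" and \<phi>: "\<phi> \<noteq> 0" using nz by auto
  have c: "cross3 (e a) (e b) = (v \<bullet> cross3 a b) *\<^sub>R \<phi>" for a b
    using cofactor_cross3[OF lin, of a b] cof by (simp add: rank_one_def)
  have swap: "v \<bullet> cross3 a b = b \<bullet> cross3 v a" for a b
    by (simp add: cross3_simps)
  \<comment> \<open>With \<open>cross3 v a\<close> as second argument the coefficient of \<phi> is a
    squared norm. So \<phi> is a nonzero multiple of a cross product with factor \<open>e a\<close>,
    and orthogonal to it.\<close>
  have img1: "\<phi> \<bullet> e a = 0" if "cross3 v a \<noteq> 0" for a
  proof -
    have "cross3 (e a) (e (cross3 v a)) = (cross3 v a \<bullet> cross3 v a) *\<^sub>R \<phi>"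
      using c[of a "cross3 v a"] swap[of a "cross3 v a"] by simp
    then have "(cross3 v a \<bullet> cross3 v a) * (\<phi> \<bullet> e a) = 0"
      by (metis dot_cross_self(3) inner_commute inner_scaleR_left dot_cross_self(1))
    with that show ?thesis by simp
  qed
  obtain z where z: "cross3 v z \<noteq> 0"
  proof (rule ccontr)
    assume "\<not> thesis"
    then have "cross3 v z = 0" for z using that by blast
    then have "cross3 v (axis 1 1) = 0" "cross3 v (axis 2 1) = 0" by blast+
    then have "v = 0" by (simp add: cross3_simps forall_3 axis_def)
    with v show False by simp
  qed
  \<comment> \<open>On the line of v the coefficient vanishes; adding a vector z off that line
    reduces to the previous case.\<close>
  have img: "\<phi> \<bullet> e a = 0" for a
  proof (cases "cross3 v a = 0")
    case True
    have "cross3 v (a + z) \<noteq> 0" using True z by (simp add: cross_add_right)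
    then have "\<phi> \<bullet> e (a + z) = 0" by (rule img1)
    with img1[OF z] show ?thesis by (simp add: linear_add[OF lin] inner_add_right)
  qed (rule img1)
  have ker: "\<exists>k. a = k *\<^sub>R v" if "e a = 0" for a
  proof -
    have "cross3 (e a) (e (cross3 v a)) = (cross3 v a \<bullet> cross3 v a) *\<^sub>R \<phi>"
      using c[of a "cross3 v a"] swap[of a "cross3 v a"] by simp
    with that \<phi> have "cross3 v a = 0" by simp
    with v show ?thesis by (metis cross3_parallel)
  qed
  show ?thesis
  proof
    fix x
    have "e (x - e x) = 0"
      using fun_cong[OF idem, of x] by (simp add: linear_diff[OF lin])
    then obtain k where k: "x - e x = k *\<^sub>R v" using ker by blast
    have "\<phi> \<bullet> x = k * (\<phi> \<bullet> v)"
      using arg_cong[OF k, of "\<lambda>u. \<phi> \<bullet> u"] img[of x] by (simp add: inner_diff_right)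
    with nz have "k = (\<phi> \<bullet> x) / (\<phi> \<bullet> v)" by simp
    with k show "e x = elem_proj v \<phi> x" by (simp add: elem_proj_def algebra_simps)
  qed
qed

lemma finite_powers_idempotent:
  assumes fin: "finite Q" and m: "m \<in> Q" and cl: "\<And>a b. a \<in> Q \<Longrightarrow> b \<in> Q \<Longrightarrow> a \<circ> b \<in> Q"
  obtains k where "k > 0" "(m ^^ k) \<circ> (m ^^ k) = m ^^ k"
proof -
  have pow: "m ^^ Suc k \<in> Q" for k
  proof (induction k)
    case (Suc k)
    show ?case using cl[OF m Suc] by (simp only: funpow.simps(2)[of "Suc k"])
  qed (simp add: m)
  have "finite (range (\<lambda>k. m ^^ Suc k))" by (rule finite_subset[OF _ fin]) (use pow in blast)
  then have "\<not> inj (\<lambda>k. m ^^ Suc k)" using finite_imageD by blast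
  then obtain i j where ij: "i < j" "m ^^ Suc i = m ^^ Suc j"
    unfolding inj_def by (metis linorder_neqE_nat)
  define d where "d = j - i"
  have d: "d > 0" "m ^^ (Suc i + d) = m ^^ Suc i" using ij by (auto simp: d_def)
  have step: "m ^^ (a + d * t) = m ^^ a" if "a \<ge> Suc i" for a t
  proof (induction t)
    case (Suc t)
    have "m ^^ (a + d * Suc t) = m ^^ ((a - Suc i + d * t) + (Suc i + d))"
      using that by (intro arg_cong[of _ _ "\<lambda>k. m ^^ k"]) simp
    also have "\<dots> = (m ^^ (a - Suc i + d * t)) \<circ> (m ^^ (Suc i + d))" by (rule funpow_add)
    also have "\<dots> = (m ^^ (a - Suc i + d * t)) \<circ> (m ^^ Suc i)" by (simp only: d(2))
    also have "\<dots> = m ^^ (a - Suc i + d * t + Suc i)" by (rule funpow_add[symmetric])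
    also have "a - Suc i + d * t + Suc i = a + d * t" using that by simp
    finally show ?case using Suc by simp
  qed simp
  \<comment> \<open>An exponent that is a multiple of the period d and not below
    \<open>Suc i\<close>, where periodicity begins; doubling it leaves the power unchanged.\<close>
  have "Suc i * d \<ge> Suc i" using d(1) by (cases d) auto
  from step[OF this, of "Suc i"] have "m ^^ (Suc i * d + Suc i * d) = m ^^ (Suc i * d)"
    by (simp only: mult.commute[of d "Suc i"])
  then have "(m ^^ (Suc i * d)) \<circ> (m ^^ (Suc i * d)) = m ^^ (Suc i * d)" by (simp only: funpow_add)
  moreover have "Suc i * d > 0" using d(1) by simp
  ultimately show ?thesis using that by blast
qed

section \<open>Matrices of functionals and vectors\<close>

text \<open>Representatives are normalised up to sign, so within \<Phi> or within V this turns out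
  to be the relation of spanning the same line.\<close>

definition par :: "real ^ 3 \<Rightarrow> real ^ 3 \<Rightarrow> bool" where
  "par a b \<longleftrightarrow> a = b \<or> a = - b"

lemma par_refl: "par a a" and par_sym: "par a b \<Longrightarrow> par b a"
  and par_trans: "par a b \<Longrightarrow> par b c \<Longrightarrow> par a c"
  by (auto simp: par_def)

lemma par_inner_iff: "par a b \<Longrightarrow> a \<bullet> x \<noteq> 0 \<longleftrightarrow> b \<bullet> x \<noteq> 0"
  by (auto simp: par_def)

definition thin :: "(real ^ 3) set \<Rightarrow> (real ^ 3) set \<Rightarrow> bool" where
  "thin \<Phi> V \<longleftrightarrow> (\<forall>v\<in>V. \<forall>a\<in>\<Phi>. \<forall>b\<in>\<Phi>. \<forall>c\<in>\<Phi>.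
     a \<bullet> v \<noteq> 0 \<longrightarrow> b \<bullet> v \<noteq> 0 \<longrightarrow> c \<bullet> v \<noteq> 0 \<longrightarrow> par a b \<or> par a c \<or> par b c)"

lemma orthogonal_to_span_UNIV:
  fixes x :: "real ^ 3"
  assumes "span S = UNIV" "\<And>s. s \<in> S \<Longrightarrow> s \<bullet> x = 0"
  shows "x = 0"
proof -
  have "span S \<subseteq> {y. y \<bullet> x = 0}"
    using assms(2) by (intro span_minimal) (auto simp: subspace_def inner_add_left)
  with assms(1) have "x \<bullet> x = 0" by blast
  then show ?thesis by simp
qed

lemma span_three_UNIV:
  fixes a b c :: "real ^ 3"
  assumes "\<And>r s t. r *\<^sub>R a + s *\<^sub>R b + t *\<^sub>R c = 0 \<Longrightarrow> r = 0 \<and> s = 0 \<and> t = 0"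
  shows "span {a, b, c} = UNIV"
proof -
  have ab: "a \<noteq> b" using assms[of 1 "-1" 0] by auto
  have ac: "a \<noteq> c" using assms[of 1 0 "-1"] by auto
  have bc: "b \<noteq> c" using assms[of 0 1 "-1"] by auto
  have ind: "independent {a, b, c}"
  proof (rule independent_if_scalars_zero)
    fix f x assume "(\<Sum>x\<in>{a, b, c}. f x *\<^sub>R x) = 0" "x \<in> {a, b, c}"
    then show "f x = 0" using assms[of "f a" "f b" "f c"] ab ac bc by (auto simp: add.assoc)
  qed simp
  have "card {a, b, c} = DIM(real ^ 3)" using ab ac bc by simp
  then show ?thesis using ind card_eq_dim[of "{a, b, c}" UNIV]
    by (metis dim_UNIV independent_card_le_dim subset_UNIV finite.intros finite_insert
        card_ge_dim_independent order_refl UNIV_I subsetI top.extremum_uniqueI)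
qed

lemma span_three_coeffs:
  fixes a b c :: "'a::real_vector"
  assumes "x \<in> span {a, b, c}"
  obtains r s t where "x = r *\<^sub>R a + s *\<^sub>R b + t *\<^sub>R c"
proof -
  obtain r where "x - r *\<^sub>R a \<in> span {b, c}" using assms by (auto simp: span_insert)
  then obtain s where "x - r *\<^sub>R a - s *\<^sub>R b \<in> span {c}" by (auto simp: span_insert)
  then obtain t where "x - r *\<^sub>R a - s *\<^sub>R b = t *\<^sub>R c" by (auto simp: span_singleton)
  then have "x = r *\<^sub>R a + s *\<^sub>R b + t *\<^sub>R c" by (simp add: algebra_simps)
  then show ?thesis by (rule that)
qed

text \<open>
  \<open>\<Phi>\<close> consists of functionals, represented by vectors via the inner product, so that \<open>\<Phi>\<close> and \<open>V\<close> play
  symmetric roles. The pattern excluded by \<open>no_hook\<close> has all entries of the upper left \<open>2 \<times> 2\<close> block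
  nonzero, third column \<open>(*, 0, ?)\<close> and third row \<open>(*, 0, ?)\<close> with \<open>* \<noteq> 0\<close>.
\<close>

locale dual_config =
  fixes \<Phi> V :: "(real ^ 3) set"
  assumes vals: "\<lbrakk>\<phi> \<in> \<Phi>; v \<in> V\<rbrakk> \<Longrightarrow> \<phi> \<bullet> v \<in> {-1, 0, 1}"
    and span_left: "span \<Phi> = UNIV"
    and span_right: "span V = UNIV"
    and nonzero: "0 \<notin> \<Phi>" "0 \<notin> V"
    and connected: "\<lbrakk>S \<subseteq> \<Phi>; T \<subseteq> V; S \<noteq> {} \<or> T \<noteq> {};
      \<And>\<phi> v. \<lbrakk>\<phi> \<in> \<Phi>; v \<in> V; \<phi> \<bullet> v \<noteq> 0\<rbrakk> \<Longrightarrow> \<phi> \<in> S \<longleftrightarrow> v \<in> T\<rbrakk> \<Longrightarrow> S = \<Phi> \<and> T = V"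
    and block: "\<lbrakk>\<phi> \<in> \<Phi>; \<psi> \<in> \<Phi>; v \<in> V; w \<in> V; \<not> par \<phi> \<psi>; \<not> par v w;
      \<phi> \<bullet> v \<noteq> 0; \<phi> \<bullet> w \<noteq> 0; \<psi> \<bullet> v \<noteq> 0; \<psi> \<bullet> w \<noteq> 0\<rbrakk> \<Longrightarrow>
      (\<phi> \<bullet> v) * (\<phi> \<bullet> w) * (\<psi> \<bullet> v) * (\<psi> \<bullet> w) = -1"
    and no_hook: "\<lbrakk>\<phi>\<^sub>1 \<in> \<Phi>; \<phi>\<^sub>2 \<in> \<Phi>; \<phi>\<^sub>3 \<in> \<Phi>; v\<^sub>1 \<in> V; v\<^sub>2 \<in> V; v\<^sub>3 \<in> V;
      \<phi>\<^sub>1 \<bullet> v\<^sub>1 \<noteq> 0; \<phi>\<^sub>1 \<bullet> v\<^sub>2 \<noteq> 0; \<phi>\<^sub>2 \<bullet> v\<^sub>1 \<noteq> 0; \<phi>\<^sub>2 \<bullet> v\<^sub>2 \<noteq> 0;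
      \<phi>\<^sub>1 \<bullet> v\<^sub>3 \<noteq> 0; \<phi>\<^sub>2 \<bullet> v\<^sub>3 = 0; \<phi>\<^sub>3 \<bullet> v\<^sub>1 \<noteq> 0; \<phi>\<^sub>3 \<bullet> v\<^sub>2 = 0\<rbrakk> \<Longrightarrow> False"
begin

text \<open>The assumptions are invariant under transposing the matrix; the hook goes to itself with
  its indices kept. Each result on rows thus gives one on columns.\<close>

lemma flip: "dual_config V \<Phi>"
proof
  show "v \<bullet> \<phi> \<in> {-1, 0, 1}" if "v \<in> V" "\<phi> \<in> \<Phi>" for v \<phi>
    using vals[OF that(2,1)] by (simp add: inner_commute)
  show "span V = UNIV" "span \<Phi> = UNIV" "0 \<notin> V" "0 \<notin> \<Phi>"
    by (fact span_right span_left nonzero)+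
  show "S = V \<and> T = \<Phi>"
    if "S \<subseteq> V" "T \<subseteq> \<Phi>" "S \<noteq> {} \<or> T \<noteq> {}"
      and "\<And>v \<phi>. \<lbrakk>v \<in> V; \<phi> \<in> \<Phi>; v \<bullet> \<phi> \<noteq> 0\<rbrakk> \<Longrightarrow> v \<in> S \<longleftrightarrow> \<phi> \<in> T" for S T
    using connected[of T S] that by (metis inner_commute)
  show "(v \<bullet> \<phi>) * (v \<bullet> \<psi>) * (w \<bullet> \<phi>) * (w \<bullet> \<psi>) = -1"
    if "v \<in> V" "w \<in> V" "\<phi> \<in> \<Phi>" "\<psi> \<in> \<Phi>" "\<not> par v w" "\<not> par \<phi> \<psi>"
      "v \<bullet> \<phi> \<noteq> 0" "v \<bullet> \<psi> \<noteq> 0" "w \<bullet> \<phi> \<noteq> 0" "w \<bullet> \<psi> \<noteq> 0" for v w \<phi> \<psi>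
    using block[of \<phi> \<psi> v w] that by (simp add: inner_commute mult_ac)
  show False
    if "v\<^sub>1 \<in> V" "v\<^sub>2 \<in> V" "v\<^sub>3 \<in> V" "\<phi>\<^sub>1 \<in> \<Phi>" "\<phi>\<^sub>2 \<in> \<Phi>" "\<phi>\<^sub>3 \<in> \<Phi>"
      "v\<^sub>1 \<bullet> \<phi>\<^sub>1 \<noteq> 0" "v\<^sub>1 \<bullet> \<phi>\<^sub>2 \<noteq> 0" "v\<^sub>2 \<bullet> \<phi>\<^sub>1 \<noteq> 0" "v\<^sub>2 \<bullet> \<phi>\<^sub>2 \<noteq> 0"
      "v\<^sub>1 \<bullet> \<phi>\<^sub>3 \<noteq> 0" "v\<^sub>2 \<bullet> \<phi>\<^sub>3 = 0" "v\<^sub>3 \<bullet> \<phi>\<^sub>1 \<noteq> 0" "v\<^sub>3 \<bullet> \<phi>\<^sub>2 = 0"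
    for v\<^sub>1 v\<^sub>2 v\<^sub>3 \<phi>\<^sub>1 \<phi>\<^sub>2 \<phi>\<^sub>3
    using no_hook[of \<phi>\<^sub>1 \<phi>\<^sub>2 \<phi>\<^sub>3 v\<^sub>1 v\<^sub>2 v\<^sub>3] that by (simp add: inner_commute)
qed

text \<open>Some v does not annihilate \<phi>, because V spans; both entries at v are then 1 or -1,
  and so is their ratio.\<close>

lemma par_if_scaled:
  assumes "\<phi> \<in> \<Phi>" "\<psi> \<in> \<Phi>" "\<phi> = c *\<^sub>R \<psi>"
  shows "par \<phi> \<psi>"
proof -
  have "\<phi> \<noteq> 0" using assms nonzero by auto
  then obtain v where v: "v \<in> V" "\<phi> \<bullet> v \<noteq> 0"
    using orthogonal_to_span_UNIV[OF span_right] by (metis inner_commute)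
  then have "c = 1 \<or> c = -1"
    using vals[OF assms(1) v(1)] vals[OF assms(2) v(1)] assms(3) by auto
  then show ?thesis using assms(3) by (auto simp: par_def)
qed

section \<open>Two by two blocks of nonzero entries\<close>

lemma sq_one: "\<lbrakk>\<phi> \<in> \<Phi>; v \<in> V; \<phi> \<bullet> v \<noteq> 0\<rbrakk> \<Longrightarrow> (\<phi> \<bullet> v) * (\<phi> \<bullet> v) = 1"
  using vals by fastforce

text \<open>Each of the six entries occurs twice in the product of the three block conditions, so
  this product is 1 and not the cube of -1.\<close>

lemma no_two_by_three:
  assumes "a \<in> \<Phi>" "b \<in> \<Phi>" "\<not> par a b" "u \<in> V" "v \<in> V" "w \<in> V"
    and "\<not> par u v" "\<not> par u w" "\<not> par v w"
    and "a \<bullet> u \<noteq> 0" "a \<bullet> v \<noteq> 0" "a \<bullet> w \<noteq> 0" "b \<bullet> u \<noteq> 0" "b \<bullet> v \<noteq> 0" "b \<bullet> w \<noteq> 0"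
  shows False
proof -
  have sq: "x * x = 1" if "x \<in> {a \<bullet> u, a \<bullet> v, a \<bullet> w, b \<bullet> u, b \<bullet> v, b \<bullet> w}" for x
    using that sq_one assms by auto
  have p: "(a \<bullet> u) * (a \<bullet> v) * (b \<bullet> u) * (b \<bullet> v) = -1" "(a \<bullet> u) * (a \<bullet> w) * (b \<bullet> u) * (b \<bullet> w) = -1"
    "(a \<bullet> v) * (a \<bullet> w) * (b \<bullet> v) * (b \<bullet> w) = -1"
    using block assms by blast+
  have "((a \<bullet> u) * (a \<bullet> v) * (b \<bullet> u) * (b \<bullet> v)) * ((a \<bullet> u) * (a \<bullet> w) * (b \<bullet> u) * (b \<bullet> w)) *
      ((a \<bullet> v) * (a \<bullet> w) * (b \<bullet> v) * (b \<bullet> w)) =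
      ((a \<bullet> u) * (a \<bullet> u)) * ((a \<bullet> v) * (a \<bullet> v)) * ((a \<bullet> w) * (a \<bullet> w)) *
      (((b \<bullet> u) * (b \<bullet> u)) * ((b \<bullet> v) * (b \<bullet> v)) * ((b \<bullet> w) * (b \<bullet> w)))"
    by (simp only: mult_ac)
  then show False by (simp add: p sq)
qed

end

lemma (in dual_config) no_three_by_two:
  assumes "a \<in> \<Phi>" "b \<in> \<Phi>" "c \<in> \<Phi>" "\<not> par a b" "\<not> par a c" "\<not> par b c" "v \<in> V" "w \<in> V" "\<not> par v w"
    and "a \<bullet> v \<noteq> 0" "b \<bullet> v \<noteq> 0" "c \<bullet> v \<noteq> 0" "a \<bullet> w \<noteq> 0" "b \<bullet> w \<noteq> 0" "c \<bullet> w \<noteq> 0"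
  shows False
  using dual_config.no_two_by_three[OF flip, of v w a b c] assms by (simp add: inner_commute)

context dual_config
begin

lemma par_right_if_scaled:
  assumes "v \<in> V" "w \<in> V" "v = c *\<^sub>R w"
  shows "par v w"
  using dual_config.par_if_scaled[OF flip assms] .

text \<open>All columns outside the block lie in the common kernel of a and b, which is a line, so
  up to sign there is at most one. A row with three nonzero entries must use v, w and that column,
  and then it forms a forbidden three by two pattern with a and b.\<close>

lemma thin_if_block_isolated:
  assumes ab: "a \<in> \<Phi>" "b \<in> \<Phi>" "\<not> par a b" and vw: "v \<in> V" "w \<in> V" "\<not> par v w"
    and nz: "a \<bullet> v \<noteq> 0" "a \<bullet> w \<noteq> 0" "b \<bullet> v \<noteq> 0" "b \<bullet> w \<noteq> 0"
    and iso: "\<And>x. \<lbrakk>x \<in> V; \<not> par x v; \<not> par x w\<rbrakk> \<Longrightarrow> a \<bullet> x = 0 \<and> b \<bullet> x = 0"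
  shows "thin V \<Phi>"
proof -
  have isopar: "par x y"
    if x: "x \<in> V" "\<not> par x v" "\<not> par x w" and y: "y \<in> V" "\<not> par y v" "\<not> par y w" for x y
  proof -
    have abnz: "cross3 a b \<noteq> 0"
    proof
      assume "cross3 a b = 0"
      then obtain c where "b = c *\<^sub>R a"
        unfolding cross_eq_0 collinear_lemma using ab nonzero by auto
      with ab show False using par_if_scaled[of b a c] par_sym by blast
    qed
    have k: "\<exists>k. z = k *\<^sub>R cross3 a b" if "a \<bullet> z = 0" "b \<bullet> z = 0" for z
    proof -
      have "cross3 (cross3 a b) z = 0"
        using that Lagrange[of z a b] cross_skew[of z "cross3 a b"] by (simp add: inner_commute)
      then show ?thesis using abnz unfolding cross_eq_0 collinear_lemma by (metis scale_zero_left)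
    qed
    obtain k l where kl: "x = k *\<^sub>R cross3 a b" "y = l *\<^sub>R cross3 a b"
      using k iso x y by metis
    have "l \<noteq> 0" using kl(2) y(1) nonzero by auto
    then have "x = (k / l) *\<^sub>R y" by (simp add: kl)
    then show ?thesis using par_right_if_scaled x y by blast
  qed
  show ?thesis
    unfolding thin_def
  proof (intro ballI impI)
    fix c x y z
    assume c: "c \<in> \<Phi>" and xyz: "x \<in> V" "y \<in> V" "z \<in> V" and nzc: "x \<bullet> c \<noteq> 0" "y \<bullet> c \<noteq> 0" "z \<bullet> c \<noteq> 0"
    show "par x y \<or> par x z \<or> par y z"
    proof (rule ccontr)
      assume np: "\<not> (par x y \<or> par x z \<or> par y z)"
      have two: "\<not> (par x r \<and> par y r)" "\<not> (par x r \<and> par z r)" "\<not> (par y r \<and> par z r)" for r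
        using np par_sym par_trans by blast+
      have "par x v \<or> par y v \<or> par z v" "par x w \<or> par y w \<or> par z w"
        using two[of v] two[of w] isopar[of x y] isopar[of x z] isopar[of y z] np xyz by auto
      then have "c \<bullet> v \<noteq> 0" "c \<bullet> w \<noteq> 0"
        using nzc par_inner_iff by (metis inner_commute)+
      moreover obtain u where u: "u \<in> {x, y, z}" "\<not> par u v" "\<not> par u w"
        using two[of v] two[of w] by auto
      then have "a \<bullet> u = 0" "b \<bullet> u = 0" "c \<bullet> u \<noteq> 0"
        using iso[of u] xyz nzc by (auto simp: inner_commute)
      then have "\<not> par a c" "\<not> par b c" using par_inner_iff by blast+
      ultimately show False using no_three_by_two[of a b c v w] ab vw nz c by blast
    qed
  qed
qed

text \<open>If both alternatives fail, the forbidden larger patterns leave exactly one nonzero entry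
  of x in the rows a, b and one of c in the columns v, w. Up to the order of rows and columns in the
  block this is the hook, hence four instances of \<open>no_hook\<close>.\<close>

lemma block_isolated:
  assumes ab: "a \<in> \<Phi>" "b \<in> \<Phi>" "\<not> par a b" and vw: "v \<in> V" "w \<in> V" "\<not> par v w"
    and nz: "a \<bullet> v \<noteq> 0" "a \<bullet> w \<noteq> 0" "b \<bullet> v \<noteq> 0" "b \<bullet> w \<noteq> 0"
    and x: "x \<in> V" "\<not> par x v" "\<not> par x w" and c: "c \<in> \<Phi>" "\<not> par c a" "\<not> par c b"
  shows "(a \<bullet> x = 0 \<and> b \<bullet> x = 0) \<or> (c \<bullet> v = 0 \<and> c \<bullet> w = 0)"
proof (rule ccontr)
  assume n: "\<not> ?thesis"
  have 1: "a \<bullet> x = 0 \<or> b \<bullet> x = 0"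
    using no_two_by_three[of a b x v w] ab vw nz x by blast
  have 2: "c \<bullet> v = 0 \<or> c \<bullet> w = 0"
    using no_three_by_two[of c a b v w] ab vw nz c by blast
  show False
    using n 1 2 no_hook[of a b c v w x] no_hook[of a b c w v x] no_hook[of b a c v w x]
      no_hook[of b a c w v x] ab vw nz x c by blast
qed

lemma thin_if_block:
  assumes ab: "a \<in> \<Phi>" "b \<in> \<Phi>" "\<not> par a b" and vw: "v \<in> V" "w \<in> V" "\<not> par v w"
    and nz: "a \<bullet> v \<noteq> 0" "a \<bullet> w \<noteq> 0" "b \<bullet> v \<noteq> 0" "b \<bullet> w \<noteq> 0"
  shows "thin \<Phi> V \<or> thin V \<Phi>"
proof (cases "\<forall>x\<in>V. \<not> par x v \<longrightarrow> \<not> par x w \<longrightarrow> a \<bullet> x = 0 \<and> b \<bullet> x = 0")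
  case True
  then show ?thesis using thin_if_block_isolated[OF assms] by blast
next
  case False
  then have "\<forall>c\<in>\<Phi>. \<not> par c a \<longrightarrow> \<not> par c b \<longrightarrow> c \<bullet> v = 0 \<and> c \<bullet> w = 0"
    using block_isolated[OF assms] by blast
  then have "thin \<Phi> V"
    using dual_config.thin_if_block_isolated[OF flip vw ab] nz by (simp add: inner_commute)
  then show ?thesis by blast
qed

text \<open>Three rows f, g, h meeting one column u form a basis, and every column other than
  \<plusminus>u meets exactly one of them. So the columns are \<plusminus>u and multiples of the
  dual basis; a row with three nonzero entries then creates a block or violates parity.\<close>

lemma thin_if_no_block:
  assumes nb: "\<And>a b v w. \<lbrakk>a \<in> \<Phi>; b \<in> \<Phi>; \<not> par a b; v \<in> V; w \<in> V; \<not> par v w;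
      a \<bullet> v \<noteq> 0; a \<bullet> w \<noteq> 0; b \<bullet> v \<noteq> 0; b \<bullet> w \<noteq> 0\<rbrakk> \<Longrightarrow> False"
    and "\<not> thin \<Phi> V"
  shows "thin V \<Phi>"
proof -
  obtain u f g h where u: "u \<in> V" and fgh: "f \<in> \<Phi>" "g \<in> \<Phi>" "h \<in> \<Phi>"
    and nzu: "f \<bullet> u \<noteq> 0" "g \<bullet> u \<noteq> 0" "h \<bullet> u \<noteq> 0" and np: "\<not> par f g" "\<not> par f h" "\<not> par g h"
    using assms(2) unfolding thin_def by blast
  have one: "(f \<bullet> v = 0 \<or> g \<bullet> v = 0) \<and> (f \<bullet> v = 0 \<or> h \<bullet> v = 0) \<and> (g \<bullet> v = 0 \<or> h \<bullet> v = 0)"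
    if "v \<in> V" "\<not> par v u" for v
    using nb[of f g v u] nb[of f h v u] nb[of g h v u] fgh nzu np u that by blast
  \<comment> \<open>The columns span, so two rows that vanish at every column except \<plusminus>u
    are proportional.\<close>
  have two_dead: False
    if a: "a \<in> \<Phi>" "a \<bullet> u \<noteq> 0" and b: "b \<in> \<Phi>" "b \<bullet> u \<noteq> 0" and nab: "\<not> par a b"
      and dead: "\<And>v. v \<in> V \<Longrightarrow> \<not> par v u \<Longrightarrow> a \<bullet> v = 0 \<and> b \<bullet> v = 0" for a b
  proof -
    define c where "c = (a \<bullet> u) / (b \<bullet> u)"
    have "v \<bullet> (a - c *\<^sub>R b) = 0" if "v \<in> V" for v
      using dead[OF that] b(2) by (cases "par v u") (auto simp: c_def par_def inner_diff_right inner_commute)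
    then have "a - c *\<^sub>R b = 0" using orthogonal_to_span_UNIV[OF span_right] by blast
    then show False using par_if_scaled[of a b c] a b nab by simp
  qed
  \<comment> \<open>Away from u at most one of f, g, h is nonzero, so a linear relation must vanish
    there term by term.\<close>
  have rel: "\<lbrakk>r *\<^sub>R f + s *\<^sub>R g + t *\<^sub>R h = 0; v \<in> V; \<not> par v u\<rbrakk> \<Longrightarrow>
      (r = 0 \<or> f \<bullet> v = 0) \<and> (s = 0 \<or> g \<bullet> v = 0) \<and> (t = 0 \<or> h \<bullet> v = 0)" for r s t v
  proof -
    assume *: "r *\<^sub>R f + s *\<^sub>R g + t *\<^sub>R h = 0" and v: "v \<in> V" "\<not> par v u"
    from arg_cong[OF *, of "\<lambda>z. z \<bullet> v"] have "r * (f \<bullet> v) + s * (g \<bullet> v) + t * (h \<bullet> v) = 0"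
      by (simp add: inner_add_left)
    with one[OF v] show ?thesis by auto
  qed
  have nf: "f \<noteq> 0" "g \<noteq> 0" "h \<noteq> 0" using nzu by auto
  have "span {f, g, h} = UNIV"
  proof (rule span_three_UNIV)
    fix r s t assume *: "r *\<^sub>R f + s *\<^sub>R g + t *\<^sub>R h = 0"
    have "r = 0 \<or> s = 0" "r = 0 \<or> t = 0" "s = 0 \<or> t = 0"
      using two_dead[of f g] two_dead[of f h] two_dead[of g h] rel[OF *] fgh nzu np by blast+
    then show "r = 0 \<and> s = 0 \<and> t = 0" using * nf by auto
  qed
  then have det: "x = 0" if "f \<bullet> x = 0" "g \<bullet> x = 0" "h \<bullet> x = 0" for x
    using orthogonal_to_span_UNIV that by blast
  have same: "par x y"
    if x: "x \<in> V" "\<not> par x u" and y: "y \<in> V" "\<not> par y u" and a: "a \<in> {f, g, h}" "a \<bullet> x \<noteq> 0" "a \<bullet> y \<noteq> 0"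
    for a x y
  proof -
    have d: "b \<bullet> x = 0 \<and> b \<bullet> y = 0" if "b \<in> {f, g, h}" "b \<noteq> a" for b
      using one[OF x] one[OF y] a that by auto
    define c where "c = (a \<bullet> x) / (a \<bullet> y)"
    have "b \<bullet> (x - c *\<^sub>R y) = 0" if "b \<in> {f, g, h}" for b
      using d[OF that] a(3) by (cases "b = a") (auto simp: c_def inner_diff_right)
    then have "x - c *\<^sub>R y = 0" using det by blast
    then show ?thesis using par_right_if_scaled[of x y c] x y by simp
  qed
  have alive: "\<exists>a\<in>{f, g, h}. a \<bullet> v \<noteq> 0" if "v \<in> V" for v
    using det[of v] nonzero that by auto
  show ?thesis
    unfolding thin_def
  proof (intro ballI impI)
    fix k x y z
    assume k: "k \<in> \<Phi>" and xyz: "x \<in> V" "y \<in> V" "z \<in> V"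
      and nzk: "x \<bullet> k \<noteq> 0" "y \<bullet> k \<noteq> 0" "z \<bullet> k \<noteq> 0"
    show "par x y \<or> par x z \<or> par y z"
    proof (rule ccontr)
      assume npx: "\<not> (par x y \<or> par x z \<or> par y z)"
      show False
      proof (cases "k \<bullet> u = 0")
        case False
        \<comment> \<open>Both k and a are nonzero at u and at v, so the absence of blocks
          identifies them up to sign.\<close>
        have park: "par k a" if "v \<in> {x, y, z}" "\<not> par v u" "a \<in> {f, g, h}" "a \<bullet> v \<noteq> 0" for v a
          using nb[of k a v u] that k fgh xyz u nzk nzu False by (auto simp: inner_commute)
        have clash: False
          if v: "v \<in> {x, y, z}" "\<not> par v u" and w: "w \<in> {x, y, z}" "\<not> par w u" and n: "\<not> par v w" for v w
        proof -
          have vV: "v \<in> V" and wV: "w \<in> V" using v w xyz by auto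
          obtain a where a: "a \<in> {f, g, h}" "a \<bullet> v \<noteq> 0" using alive vV by blast
          have "w \<bullet> k \<noteq> 0" using w nzk by auto
          then have "a \<bullet> w \<noteq> 0" using par_inner_iff[OF park[OF v a]] by (simp add: inner_commute)
          then show False using same[OF vV v(2) wV w(2) a] n by blast
        qed
        have "par x u \<or> par y u" "par x u \<or> par z u" "par y u \<or> par z u"
          using clash[of x y] clash[of x z] clash[of y z] npx by auto
        then show False using npx par_sym par_trans by blast
      next
        case True
        have npu: "\<not> par v u" if "v \<in> {x, y, z}" for v
          using that True nzk par_inner_iff[of v u k] by (auto simp: inner_commute)
        obtain a where a: "a \<in> {f, g, h}" "a \<bullet> x \<noteq> 0" using alive[OF xyz(1)] by blast
        obtain b where b: "b \<in> {f, g, h}" "b \<bullet> y \<noteq> 0" using alive[OF xyz(2)] by blast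
        obtain c where c: "c \<in> {f, g, h}" "c \<bullet> z \<noteq> 0" using alive[OF xyz(3)] by blast
        note abc = a b c
        have dead: "d \<bullet> w = 0"
          if "d \<in> {f, g, h}" "d \<bullet> v \<noteq> 0" and v: "v \<in> {x, y, z}" and w: "w \<in> {x, y, z}" and "\<not> par v w"
          for d v w
        proof (rule ccontr)
          assume "d \<bullet> w \<noteq> 0"
          moreover have "v \<in> V" "w \<in> V" using v w xyz by auto
          ultimately show False using same[of v w d] npu[OF v] npu[OF w] that by blast
        qed
        have np6: "\<not> par x y" "\<not> par x z" "\<not> par y z" "\<not> par y x" "\<not> par z x" "\<not> par z y"
          using npx par_sym by blast+
        have dist: "a \<bullet> y = 0" "a \<bullet> z = 0" "b \<bullet> x = 0" "b \<bullet> z = 0" "c \<bullet> x = 0" "c \<bullet> y = 0"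
          using dead[OF a _ _ np6(1)] dead[OF a _ _ np6(2)] dead[OF b _ _ np6(4)] dead[OF b _ _ np6(3)]
            dead[OF c _ _ np6(5)] dead[OF c _ _ np6(6)] by simp_all
        then have ne: "a \<noteq> b" "a \<noteq> c" "b \<noteq> c" using a(2) b(2) by metis+
        have all: "d \<in> {a, b, c}" if "d \<in> {f, g, h}" for d
          using that ne abc(1,3,5) by auto
        \<comment> \<open>The coordinates of u in x, y, z, which are dual to a, b, c up to scalars.
          As quotients of nonzero entries they are 1 or -1.\<close>
        define p q r where "p = (a \<bullet> u) / (a \<bullet> x)" and "q = (b \<bullet> u) / (b \<bullet> y)" and "r = (c \<bullet> u) / (c \<bullet> z)"
        have "d \<bullet> (u - p *\<^sub>R x - q *\<^sub>R y - r *\<^sub>R z) = 0" if "d \<in> {f, g, h}" for d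
          using all[OF that] abc dist by (auto simp: p_def q_def r_def inner_diff_right)
        then have "u - p *\<^sub>R x - q *\<^sub>R y - r *\<^sub>R z = 0" using det by blast
        then have "u = p *\<^sub>R x + q *\<^sub>R y + r *\<^sub>R z" by (simp add: algebra_simps)
        then have eq: "0 = p * (k \<bullet> x) + q * (k \<bullet> y) + r * (k \<bullet> z)"
          using True by (simp add: inner_add_right)
        have pm: "\<phi> \<bullet> v \<in> {-1, 1}" if "\<phi> \<in> \<Phi>" "v \<in> V" "\<phi> \<bullet> v \<noteq> 0" for \<phi> v
          using vals[OF that(1,2)] that(3) by blast
        have quot: "s / t \<in> {-1, 1}" if "s \<in> {-1, 1}" "t \<in> {-1, 1}" for s t :: real
          using that by auto
        have in3: "a \<in> \<Phi>" "b \<in> \<Phi>" "c \<in> \<Phi>" "a \<bullet> u \<noteq> 0" "b \<bullet> u \<noteq> 0" "c \<bullet> u \<noteq> 0"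
          using abc fgh nzu by auto
        have "p \<in> {-1, 1}" "q \<in> {-1, 1}" "r \<in> {-1, 1}"
          unfolding p_def q_def r_def using in3 u xyz abc by (intro quot pm; blast)+
        moreover have "k \<bullet> x \<in> {-1, 1}" "k \<bullet> y \<in> {-1, 1}" "k \<bullet> z \<in> {-1, 1}"
          using k xyz nzk by (intro pm; simp only: inner_commute not_False_eq_True)+
        \<comment> \<open>A sum of three numbers, each 1 or -1, is odd and cannot be zero.\<close>
        ultimately show False using eq by auto
      qed
    qed
  qed
qed

lemma thin_either: "thin \<Phi> V \<or> thin V \<Phi>"
proof (rule ccontr)
  assume n: "\<not> (thin \<Phi> V \<or> thin V \<Phi>)"
  have "thin V \<Phi>"
  proof (rule thin_if_no_block)
    show "\<not> thin \<Phi> V" using n by blast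
    show False
      if "a \<in> \<Phi>" "b \<in> \<Phi>" "\<not> par a b" "v \<in> V" "w \<in> V" "\<not> par v w"
        "a \<bullet> v \<noteq> 0" "a \<bullet> w \<noteq> 0" "b \<bullet> v \<noteq> 0" "b \<bullet> w \<noteq> 0" for a b v w
      using n thin_if_block[OF that] by blast
  qed
  with n show False by blast
qed

end

section \<open>Frames: the vertices of the signed graph\<close>

definition signed_frame :: "(real ^ 3) set \<Rightarrow> (real ^ 3) set \<Rightarrow> (3 \<Rightarrow> real ^ 3) \<Rightarrow> bool" where
  "signed_frame \<Phi> V y \<longleftrightarrow> range y \<subseteq> \<Phi> \<and> span (range y) = UNIV \<and>
     (\<forall>\<phi>\<in>\<Phi>. \<exists>i. par \<phi> (y i)) \<and> (\<forall>v\<in>V. \<exists>i. y i \<bullet> v = 0)"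

text \<open>Four functionals with sum zero give coordinates in the space of type A, where each v
  becomes a multiple of a difference of two unit vectors. The scalar \<open>c\<close> is there
  because the functionals had to be rescaled to sum to zero and may leave \<Phi>.\<close>

definition balanced_frame :: "(real ^ 3) set \<Rightarrow> (real ^ 3) set \<Rightarrow> (4 \<Rightarrow> real ^ 3) \<Rightarrow> bool" where
  "balanced_frame \<Phi> V y \<longleftrightarrow> (\<Sum>i\<in>UNIV. y i) = 0 \<and> span (range y) = UNIV \<and>
     (\<forall>\<phi>\<in>\<Phi>. \<exists>i c. c \<noteq> 0 \<and> \<phi> = c *\<^sub>R y i) \<and>
     (\<forall>v\<in>V. \<exists>i j. i \<noteq> j \<and> (\<forall>k. k \<noteq> i \<longrightarrow> k \<noteq> j \<longrightarrow> y k \<bullet> v = 0))"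

text \<open>A relation among numbers cannot have exactly one nonzero term. Products are split into
  factors because \<open>thin_frame\<close> uses the coefficient and the entry separately.\<close>

lemma two_summands:
  fixes d x y z r s t :: real
  assumes "d = r * x + s * y + t * z"
    and "d \<noteq> 0 \<or> (r \<noteq> 0 \<and> x \<noteq> 0) \<or> (s \<noteq> 0 \<and> y \<noteq> 0) \<or> (t \<noteq> 0 \<and> z \<noteq> 0)"
  shows "d \<noteq> 0 \<and> r \<noteq> 0 \<and> x \<noteq> 0 \<or> d \<noteq> 0 \<and> s \<noteq> 0 \<and> y \<noteq> 0 \<or> d \<noteq> 0 \<and> t \<noteq> 0 \<and> z \<noteq> 0 \<or>
    (r \<noteq> 0 \<and> x \<noteq> 0) \<and> s \<noteq> 0 \<and> y \<noteq> 0 \<or> (r \<noteq> 0 \<and> x \<noteq> 0) \<and> t \<noteq> 0 \<and> z \<noteq> 0 \<or>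
    (s \<noteq> 0 \<and> y \<noteq> 0) \<and> t \<noteq> 0 \<and> z \<noteq> 0"
proof -
  have "d = 0 \<or> r * x \<noteq> 0 \<or> s * y \<noteq> 0 \<or> t * z \<noteq> 0" using assms(1) by auto
  moreover have "\<not> (d = 0 \<and> r * x = 0 \<and> s * y = 0 \<and> t * z \<noteq> 0)"
    "\<not> (d = 0 \<and> r * x = 0 \<and> s * y \<noteq> 0 \<and> t * z = 0)" "\<not> (d = 0 \<and> r * x \<noteq> 0 \<and> s * y = 0 \<and> t * z = 0)"
    using assms(1) by auto
  ultimately show ?thesis using assms(2) unfolding mult_eq_0_iff by argo
qed

context dual_config
begin

lemma obtain_basis:
  obtains a b c where "a \<in> \<Phi>" "b \<in> \<Phi>" "c \<in> \<Phi>" "span {a, b, c} = UNIV"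
    "\<not> par a b" "\<not> par a c" "\<not> par b c"
proof -
  obtain B where B: "B \<subseteq> \<Phi>" "independent B" "\<Phi> \<subseteq> span B" "card B = dim \<Phi>"
    using basis_exists[of \<Phi>] by blast
  have "span B = UNIV" using B(3) span_left span_mono[OF B(3)] unfolding span_span by blast
  moreover have "dim \<Phi> = 3" using dim_span[of \<Phi>] span_left by simp
  then obtain a b c where abc: "B = {a, b, c}" "a \<noteq> b" "a \<noteq> c" "b \<noteq> c"
    using B(4) by (auto simp: card_3_iff)
  have np: "\<not> par p q" if "p \<in> B" "q \<in> B" "p \<noteq> q" for p q
  proof
    assume "par p q"
    then have "p = - q" using that by (simp add: par_def)
    then have "p \<in> span {q}" by (simp add: span_neg span_base)
    moreover have "span {q} \<subseteq> span (B - {p})" using that by (intro span_mono) auto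
    ultimately show False using B(2) that(1) unfolding dependent_def by blast
  qed
  ultimately show ?thesis using that[of a b c] abc B(1) np by auto
qed

text \<open>If \<Phi> is a basis up to sign, thinness applied to this basis gives the signed frame.
  Otherwise a fourth functional satisfies a relation whose support is all of \<Phi> by
  connectedness; rescaled, this relation is the balanced frame.\<close>

lemma thin_frame:
  assumes thin: "thin \<Phi> V"
  shows "(\<exists>y. signed_frame \<Phi> V y) \<or> (\<exists>y. balanced_frame \<Phi> V y)"
proof -
  obtain a b c where abc: "a \<in> \<Phi>" "b \<in> \<Phi>" "c \<in> \<Phi>" and sp: "span {a, b, c} = UNIV"
    and np: "\<not> par a b" "\<not> par a c" "\<not> par b c"
    by (rule obtain_basis)
  have thinD: "\<lbrakk>v \<in> V; p \<in> \<Phi>; q \<in> \<Phi>; r \<in> \<Phi>; p \<bullet> v \<noteq> 0; q \<bullet> v \<noteq> 0; r \<bullet> v \<noteq> 0\<rbrakk> \<Longrightarrow>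
      par p q \<or> par p r \<or> par q r" for v p q r
    using thin unfolding thin_def by blast
  show ?thesis
  proof (cases "\<forall>\<phi>\<in>\<Phi>. par \<phi> a \<or> par \<phi> b \<or> par \<phi> c")
    case True
    define y :: "3 \<Rightarrow> real ^ 3" where "y i = (if i = 1 then a else if i = 2 then b else c)" for i
    have y: "y 1 = a" "y 2 = b" "y 3 = c" by (auto simp: y_def)
    have r: "range y = {a, b, c}" unfolding UNIV_3 by (simp add: y)
    have ex: "(\<exists>i. P i) \<longleftrightarrow> P 1 \<or> P 2 \<or> P 3" for P :: "3 \<Rightarrow> bool"
      using forall_3[of "\<lambda>i. \<not> P i"] by blast
    have "signed_frame \<Phi> V y"
      unfolding signed_frame_def r ex y using True sp abc thinD[OF _ abc] np by blast
    then show ?thesis by blast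
  next
    case False
    then obtain d where d: "d \<in> \<Phi>" "\<not> par d a" "\<not> par d b" "\<not> par d c" by blast
    obtain \<alpha> \<beta> \<gamma> where lin: "d = \<alpha> *\<^sub>R a + \<beta> *\<^sub>R b + \<gamma> *\<^sub>R c"
      using span_three_coeffs[of d a b c] sp by auto
    \<comment> \<open>\<open>S\<close> is the support of the relation between \<open>a, b, c, d\<close>; a vector not annihilated by \<open>S\<close> has two
      nonzero entries in \<open>S\<close>, hence none outside, and so \<open>S\<close> is a connected component.\<close>
    define S where "S = {\<phi> \<in> \<Phi>. par \<phi> d \<or> (\<alpha> \<noteq> 0 \<and> par \<phi> a) \<or> (\<beta> \<noteq> 0 \<and> par \<phi> b) \<or> (\<gamma> \<noteq> 0 \<and> par \<phi> c)}"
    define T where "T = {v \<in> V. \<exists>\<phi>\<in>S. \<phi> \<bullet> v \<noteq> 0}"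
    have parS: "q \<in> S" if "p \<in> S" "q \<in> \<Phi>" "par q p" for p q
      using that par_trans unfolding S_def by blast
    have two: "\<exists>p\<in>S. \<exists>q\<in>S. \<not> par p q \<and> p \<bullet> v \<noteq> 0 \<and> q \<bullet> v \<noteq> 0" if "v \<in> T" for v
    proof -
      obtain \<phi> where \<phi>: "\<phi> \<in> S" "\<phi> \<bullet> v \<noteq> 0" using \<open>v \<in> T\<close> by (auto simp: T_def)
      have eq: "d \<bullet> v = \<alpha> * (a \<bullet> v) + \<beta> * (b \<bullet> v) + \<gamma> * (c \<bullet> v)"
        by (simp add: lin inner_add_left)
      have rep: "d \<bullet> v \<noteq> 0 \<or> (\<alpha> \<noteq> 0 \<and> a \<bullet> v \<noteq> 0) \<or> (\<beta> \<noteq> 0 \<and> b \<bullet> v \<noteq> 0) \<or> (\<gamma> \<noteq> 0 \<and> c \<bullet> v \<noteq> 0)"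
        using \<phi> par_inner_iff unfolding S_def by blast
      have mem: "d \<in> S" "\<alpha> \<noteq> 0 \<Longrightarrow> a \<in> S" "\<beta> \<noteq> 0 \<Longrightarrow> b \<in> S" "\<gamma> \<noteq> 0 \<Longrightarrow> c \<in> S"
        using d abc par_refl by (auto simp: S_def)
      let ?A = "\<alpha> \<noteq> 0 \<and> a \<bullet> v \<noteq> 0" and ?B = "\<beta> \<noteq> 0 \<and> b \<bullet> v \<noteq> 0" and ?C = "\<gamma> \<noteq> 0 \<and> c \<bullet> v \<noteq> 0"
      have "d \<bullet> v \<noteq> 0 \<and> ?A \<or> d \<bullet> v \<noteq> 0 \<and> ?B \<or> d \<bullet> v \<noteq> 0 \<and> ?C \<or> ?A \<and> ?B \<or> ?A \<and> ?C \<or> ?B \<and> ?C"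
        by (rule two_summands[OF eq rep])
      then consider "d \<bullet> v \<noteq> 0" ?A | "d \<bullet> v \<noteq> 0" ?B | "d \<bullet> v \<noteq> 0" ?C | ?A ?B | ?A ?C | ?B ?C
        by argo
      then obtain p q where "p \<in> S" "q \<in> S" "\<not> par p q" "p \<bullet> v \<noteq> 0" "q \<bullet> v \<noteq> 0"
        by cases (use mem np d(2,3,4) that in metis)+
      then show ?thesis by blast
    qed
    have "S = \<Phi> \<and> T = V"
    proof (rule connected)
      show "S \<subseteq> \<Phi>" "T \<subseteq> V" by (auto simp: S_def T_def)
      show "S \<noteq> {} \<or> T \<noteq> {}" using d(1) par_refl by (auto simp: S_def)
      fix \<phi> v assume *: "\<phi> \<in> \<Phi>" "v \<in> V" "\<phi> \<bullet> v \<noteq> 0"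
      show "\<phi> \<in> S \<longleftrightarrow> v \<in> T"
      proof
        assume "\<phi> \<in> S" then show "v \<in> T" using * by (auto simp: T_def)
      next
        assume "v \<in> T"
        then obtain p q where pq: "p \<in> S" "q \<in> S" "\<not> par p q" "p \<bullet> v \<noteq> 0" "q \<bullet> v \<noteq> 0"
          using two by blast
        then have "p \<in> \<Phi>" "q \<in> \<Phi>" by (auto simp: S_def)
        then show "\<phi> \<in> S" using thinD[OF *(2,1), of p q] * pq parS par_sym by blast
      qed
    qed
    then have S: "S = \<Phi>" by blast
    \<comment> \<open>Now a, b, c belong to S. As they are not parallel to d or to one another, each
      is in S only through its own coefficient.\<close>
    have coeffs: "\<alpha> \<noteq> 0" "\<beta> \<noteq> 0" "\<gamma> \<noteq> 0"
      using abc np d par_sym unfolding S[symmetric] by (auto simp: S_def)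
    \<comment> \<open>Absorbing the coefficients turns the relation into a vanishing sum; the last
      branch serves the index \<open>4 = 0\<close>.\<close>
    define y :: "4 \<Rightarrow> real ^ 3" where
      "y i = (if i = 1 then \<alpha> *\<^sub>R a else if i = 2 then \<beta> *\<^sub>R b else if i = 3 then \<gamma> *\<^sub>R c else - d)" for i
    have y: "y 1 = \<alpha> *\<^sub>R a" "y 2 = \<beta> *\<^sub>R b" "y 3 = \<gamma> *\<^sub>R c" "y 4 = - d" by (auto simp: y_def)
    have "balanced_frame \<Phi> V y"
      unfolding balanced_frame_def
    proof (intro conjI ballI)
      show "(\<Sum>i\<in>UNIV. y i) = 0" by (simp add: sum_4 y lin)
      have "a \<in> span (range y)"
      proof -
        have "(1 / \<alpha>) *\<^sub>R y 1 \<in> span (range y)" by (intro span_scale span_base) simp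
        then show ?thesis using coeffs by (simp add: y)
      qed
      moreover have "b \<in> span (range y)"
      proof -
        have "(1 / \<beta>) *\<^sub>R y 2 \<in> span (range y)" by (intro span_scale span_base) simp
        then show ?thesis using coeffs by (simp add: y)
      qed
      moreover have "c \<in> span (range y)"
      proof -
        have "(1 / \<gamma>) *\<^sub>R y 3 \<in> span (range y)" by (intro span_scale span_base) simp
        then show ?thesis using coeffs by (simp add: y)
      qed
      ultimately have "span {a, b, c} \<subseteq> span (range y)"
        by (intro span_minimal) auto
      then show "span (range y) = UNIV" using sp by blast
    next
      fix \<phi> assume "\<phi> \<in> \<Phi>"
      then have "par \<phi> a \<or> par \<phi> b \<or> par \<phi> c \<or> par \<phi> d" unfolding S[symmetric] by (auto simp: S_def)
      then have "\<exists>i e. e \<noteq> 0 \<and> y i = e *\<^sub>R \<phi>"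
      proof (elim disjE)
        assume "par \<phi> a"
        then have "y 1 = \<alpha> *\<^sub>R \<phi> \<or> y 1 = (- \<alpha>) *\<^sub>R \<phi>" by (auto simp: par_def y)
        then show ?thesis using coeffs by (metis neg_equal_0_iff_equal)
      next
        assume "par \<phi> b"
        then have "y 2 = \<beta> *\<^sub>R \<phi> \<or> y 2 = (- \<beta>) *\<^sub>R \<phi>" by (auto simp: par_def y)
        then show ?thesis using coeffs by (metis neg_equal_0_iff_equal)
      next
        assume "par \<phi> c"
        then have "y 3 = \<gamma> *\<^sub>R \<phi> \<or> y 3 = (- \<gamma>) *\<^sub>R \<phi>" by (auto simp: par_def y)
        then show ?thesis using coeffs by (metis neg_equal_0_iff_equal)
      next
        assume "par \<phi> d"
        then have "y 4 = 1 *\<^sub>R \<phi> \<or> y 4 = (- 1) *\<^sub>R \<phi>" by (auto simp: par_def y)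
        then show ?thesis by (metis neg_equal_0_iff_equal one_neq_zero)
      qed
      then obtain i e where "e \<noteq> 0" "y i = e *\<^sub>R \<phi>" by blast
      then have "1 / e \<noteq> 0" "\<phi> = (1 / e) *\<^sub>R y i" by auto
      then show "\<exists>i c. c \<noteq> 0 \<and> \<phi> = c *\<^sub>R y i" by blast
    next
      fix v assume v: "v \<in> V"
      have "a \<bullet> v = 0 \<or> b \<bullet> v = 0 \<or> c \<bullet> v = 0" "a \<bullet> v = 0 \<or> b \<bullet> v = 0 \<or> d \<bullet> v = 0"
        "a \<bullet> v = 0 \<or> c \<bullet> v = 0 \<or> d \<bullet> v = 0" "b \<bullet> v = 0 \<or> c \<bullet> v = 0 \<or> d \<bullet> v = 0"
        using thinD[OF v abc(1) abc(2) abc(3)] thinD[OF v abc(1) abc(2) d(1)]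
          thinD[OF v abc(1) abc(3) d(1)] thinD[OF v abc(2) abc(3) d(1)] np d(2-4) par_sym by blast+
      then consider "a \<bullet> v = 0" "b \<bullet> v = 0" | "a \<bullet> v = 0" "c \<bullet> v = 0" | "a \<bullet> v = 0" "d \<bullet> v = 0"
        | "b \<bullet> v = 0" "c \<bullet> v = 0" | "b \<bullet> v = 0" "d \<bullet> v = 0" | "c \<bullet> v = 0" "d \<bullet> v = 0"
        by argo
      then show "\<exists>i j. i \<noteq> j \<and> (\<forall>k. k \<noteq> i \<longrightarrow> k \<noteq> j \<longrightarrow> y k \<bullet> v = 0)"
      proof cases
        case 1 then show ?thesis unfolding forall_4 y by (intro exI[of _ 3] exI[of _ 4]) simp
      next
        case 2 then show ?thesis unfolding forall_4 y by (intro exI[of _ 2] exI[of _ 4]) simp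
      next
        case 3 then show ?thesis unfolding forall_4 y by (intro exI[of _ 2] exI[of _ 3]) simp
      next
        case 4 then show ?thesis unfolding forall_4 y by (intro exI[of _ 1] exI[of _ 4]) simp
      next
        case 5 then show ?thesis unfolding forall_4 y by (intro exI[of _ 1] exI[of _ 3]) simp
      next
        case 6 then show ?thesis unfolding forall_4 y by (intro exI[of _ 1] exI[of _ 2]) simp
      qed
    qed
    then show ?thesis by blast
  qed
qed

end

section \<open>The matrix of a finite irreducible monoid\<close>

lemma finite_real_powers:
  fixes c :: real
  assumes "finite (range (\<lambda>k. c ^ Suc k))"
  shows "c \<in> {-1, 0, 1}"
proof (rule ccontr)
  assume c: "c \<notin> {-1, 0, 1}"
  have "\<not> inj (\<lambda>k. c ^ Suc k)" using assms finite_imageD by blast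
  then obtain i j where ij: "i < j" "c ^ Suc i = c ^ Suc j"
    unfolding inj_def by (metis linorder_neqE_nat)
  have "c ^ Suc j = c ^ Suc i * c ^ (j - i)" using ij(1) by (simp flip: power_add)
  then have "c ^ (j - i) = 1" using ij(2) c by simp
  then have "\<bar>c\<bar> ^ (j - i) = 1" by (simp flip: power_abs)
  then have "\<bar>c\<bar> = 1" using ij(1) by (metis abs_ge_zero power_eq_1_iff zero_less_diff abs_abs real_norm_def neq0_conv)
  with c show False by auto
qed

text \<open>A pair \<open>(w, \<theta>) \<in> P\<close> stands for the projection \<open>x \<mapsto> x - (\<theta> \<bullet> x) w\<close>.\<close>

locale finite_projections =
  fixes M :: "(real ^ 3 \<Rightarrow> real ^ 3) set" and P :: "((real ^ 3) \<times> (real ^ 3)) set"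
  assumes fin: "finite M"
    and lin: "m \<in> M \<Longrightarrow> linear m"
    and comp: "\<lbrakk>m \<in> M; n \<in> M\<rbrakk> \<Longrightarrow> m \<circ> n \<in> M"
    and unit: "(w, \<theta>) \<in> P \<Longrightarrow> \<theta> \<bullet> w = 1"
    and gen: "(w, \<theta>) \<in> P \<Longrightarrow> elem_proj w \<theta> \<in> M"
    and irreducible: "\<lbrakk>subspace W; \<And>w \<theta>. (w, \<theta>) \<in> P \<Longrightarrow> w \<in> W \<or> (\<forall>x\<in>W. \<theta> \<bullet> x = 0)\<rbrakk> \<Longrightarrow>
      W = {0} \<or> W = UNIV"
begin

section \<open>Finite orbits and elements of infinite order\<close>

lemma finite_orbit:
  assumes "m \<in> M"
  shows "finite (range (\<lambda>n. (m ^^ n) x))"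
proof -
  have pow: "m ^^ Suc n \<in> M" for n
  proof (induction n)
    case (Suc n)
    show ?case using comp[OF assms Suc] by (simp only: funpow.simps(2)[of "Suc n"])
  qed (simp add: assms)
  have "(m ^^ n) x \<in> insert x ((\<lambda>f. f x) ` M)" for n
  proof (cases n)
    case (Suc k)
    then show ?thesis using imageI[OF pow[of k], of "\<lambda>f. f x"] by simp
  qed simp
  then have "range (\<lambda>n. (m ^^ n) x) \<subseteq> insert x ((\<lambda>f. f x) ` M)" by blast
  then show ?thesis using fin finite_subset by blast
qed

lemma no_shear:
  assumes m: "m \<in> M" and "m u = u" "m x = x + u"
  shows "u = 0"
proof (rule ccontr)
  assume u: "u \<noteq> 0"
  have "(m ^^ n) x = x + real n *\<^sub>R u" for n
  proof (induction n)
    case (Suc n)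
    then show ?case
      using assms by (simp add: linear_add[OF lin[OF m]] linear_scale[OF lin[OF m]] algebra_simps)
  qed simp
  then have "inj (\<lambda>n. (m ^^ n) x)" using u by (auto simp: inj_def)
  then show False using finite_orbit[OF m, of x] finite_imageD infinite_UNIV_nat by blast
qed

text \<open>The values of \<psi> along the orbit of x are multiplied by c at each step, so a finite
  orbit forces the powers of c to repeat. The set X confines the eigenvector condition on \<psi> to
  where it holds.\<close>

lemma no_expansion:
  assumes m: "m \<in> M" and X: "x \<in> X" "\<psi> \<bullet> x \<noteq> 0" and c: "c \<notin> {-1, 0, 1}"
    and step: "\<And>y. y \<in> X \<Longrightarrow> m y \<in> X \<and> \<psi> \<bullet> m y = c * (\<psi> \<bullet> y)"
  shows False
proof -
  have *: "(m ^^ n) x \<in> X \<and> \<psi> \<bullet> (m ^^ n) x = c ^ n * (\<psi> \<bullet> x)" for n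
    by (induction n) (use X step in auto)
  have "range (\<lambda>k. c ^ Suc k) \<subseteq> (\<lambda>y. (\<psi> \<bullet> y) / (\<psi> \<bullet> x)) ` range (\<lambda>n. (m ^^ n) x)"
  proof
    fix d assume "d \<in> range (\<lambda>k. c ^ Suc k)"
    then obtain k where "d = c ^ Suc k" by blast
    then have "d = (\<psi> \<bullet> (m ^^ Suc k) x) / (\<psi> \<bullet> x)" using *[of "Suc k"] X(2) by simp
    then show "d \<in> (\<lambda>y. (\<psi> \<bullet> y) / (\<psi> \<bullet> x)) ` range (\<lambda>n. (m ^^ n) x)" by blast
  qed
  then have "finite (range (\<lambda>k. c ^ Suc k))"
    using finite_orbit[OF m] finite_surj by blast
  then show False using finite_real_powers c by blast
qed

definition Q :: "(real ^ 3 \<Rightarrow> real ^ 3) set" where "Q = cofactor ` M"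

lemma Q_comp: "\<lbrakk>p \<in> Q; q \<in> Q\<rbrakk> \<Longrightarrow> p \<circ> q \<in> Q"
  unfolding Q_def using comp lin cofactor_comp by (auto simp: image_iff) metis

lemma Q_gen: "(w, \<theta>) \<in> P \<Longrightarrow> rank_one w \<theta> \<in> Q"
  unfolding Q_def using gen cofactor_elem_proj unit by (metis image_eqI)

lemma finite_Q: "finite Q"
  unfolding Q_def using fin by simp

text \<open>Otherwise the product of the two projections is a shear.\<close>

lemma block_product:
  assumes "elem_proj v \<phi> \<in> M" "elem_proj w \<psi> \<in> M"
    and nz: "\<phi> \<bullet> v \<noteq> 0" "\<psi> \<bullet> w \<noteq> 0"
    and eq: "(\<phi> \<bullet> v) * (\<psi> \<bullet> w) = (\<phi> \<bullet> w) * (\<psi> \<bullet> v)"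
  shows "(\<exists>c. v = c *\<^sub>R w) \<or> (\<exists>c. \<phi> = c *\<^sub>R \<psi>)"
proof (rule ccontr)
  assume n: "\<not> ?thesis"
  \<comment> \<open>The component of \<phi> orthogonal to \<psi>: annihilated by \<psi>, but not by
    \<phi>, since the functionals are not proportional.\<close>
  define x where "x = \<phi> - ((\<phi> \<bullet> \<psi>) / (\<psi> \<bullet> \<psi>)) *\<^sub>R \<psi>"
  have \<psi>: "\<psi> \<noteq> 0" using nz by auto
  then have \<psi>x: "\<psi> \<bullet> x = 0" by (simp add: x_def inner_diff_right inner_commute)
  have "x \<noteq> 0" using n by (auto simp: x_def)
  moreover have "\<phi> \<bullet> x = x \<bullet> x"
    using \<psi>x by (simp add: x_def inner_diff_left)
  ultimately have \<phi>x: "\<phi> \<bullet> x \<noteq> 0" by simp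
  \<comment> \<open>The displacement of x under the product of the two projections. The hypothesis
    \<open>eq\<close> makes \<phi> vanish at u, so the product fixes u.\<close>
  define u where "u = (\<phi> \<bullet> x) *\<^sub>R (((\<psi> \<bullet> v) / ((\<phi> \<bullet> v) * (\<psi> \<bullet> w))) *\<^sub>R w - (1 / (\<phi> \<bullet> v)) *\<^sub>R v)"
  have "\<phi> \<bullet> u = (\<phi> \<bullet> x) * ((\<phi> \<bullet> w) * (\<psi> \<bullet> v) / ((\<phi> \<bullet> v) * (\<psi> \<bullet> w)) - 1)"
    using nz by (simp add: u_def inner_diff_right mult.commute)
  then have \<phi>u: "\<phi> \<bullet> u = 0" using nz by (simp flip: eq)
  have \<psi>u: "\<psi> \<bullet> u = 0"
    using nz by (simp add: u_def inner_diff_right field_simps)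
  let ?m = "elem_proj w \<psi> \<circ> elem_proj v \<phi>"
  have "?m u = u" using \<phi>u \<psi>u by (simp add: elem_proj_fixes)
  moreover have "?m x = x + u"
    using nz \<psi>x by (simp add: elem_proj_def u_def inner_diff_right algebra_simps)
  ultimately have "u = 0" using no_shear comp assms(1,2) by blast
  then have "(1 / (\<phi> \<bullet> v)) *\<^sub>R v = ((\<psi> \<bullet> v) / ((\<phi> \<bullet> v) * (\<psi> \<bullet> w))) *\<^sub>R w"
    using \<phi>x by (simp add: u_def)
  then have "v = (\<phi> \<bullet> v) *\<^sub>R (((\<psi> \<bullet> v) / ((\<phi> \<bullet> v) * (\<psi> \<bullet> w))) *\<^sub>R w)"
    using nz(1) by (metis eq_vector_fraction_iff scaleR_scaleR divide_inverse mult_1 scaleR_one right_inverse)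
  then show False using n by (metis scaleR_scaleR)
qed

end

locale based_projections = finite_projections +
  fixes a \<alpha> :: "real ^ 3"
  assumes base: "(a, \<alpha>) \<in> P"
begin

text \<open>
  Since \<open>rank_one v \<alpha> \<circ> rank_one a \<phi> = (v \<bullet> \<phi>) rank_one a \<alpha>\<close>, finiteness of \<open>Q\<close> bounds the powers of
  \<open>v \<bullet> \<phi>\<close> for the following choice of representatives.
\<close>

definition \<Phi> :: "(real ^ 3) set" where "\<Phi> = {\<phi>. \<phi> \<noteq> 0 \<and> rank_one a \<phi> \<in> Q}"
definition V :: "(real ^ 3) set" where "V = {v. v \<noteq> 0 \<and> rank_one v \<alpha> \<in> Q}"

section \<open>Normalised functionals and vectors\<close>

lemma a\<alpha>: "\<alpha> \<bullet> a = 1" "a \<bullet> \<alpha> = 1" "a \<noteq> 0" "\<alpha> \<noteq> 0"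
  using unit[OF base] by (auto simp: inner_commute)

lemma base_mem: "\<alpha> \<in> \<Phi>" "a \<in> V"
  using Q_gen[OF base] a\<alpha> by (auto simp: \<Phi>_def V_def)

lemma vals:
  assumes "\<phi> \<in> \<Phi>" "v \<in> V"
  shows "\<phi> \<bullet> v \<in> {-1, 0, 1}"
proof -
  define c where "c = v \<bullet> \<phi>"
  have 1: "rank_one a (c *\<^sub>R \<alpha>) \<in> Q"
    using Q_comp[of "rank_one v \<alpha>" "rank_one a \<phi>"] assms
    by (simp add: rank_one_comp \<Phi>_def V_def c_def)
  have k: "rank_one a (c ^ Suc k *\<^sub>R \<alpha>) \<in> Q" for k
  proof (induction k)
    case (Suc k)
    then show ?case using Q_comp[OF Suc 1] by (simp add: rank_one_comp a\<alpha> mult_ac)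
  qed (use 1 in simp)
  have "inj (\<lambda>d. rank_one a (d *\<^sub>R \<alpha>))"
    using a\<alpha> rank_one_inj by (auto simp: inj_def) (metis scaleR_cancel_right)
  moreover have "(\<lambda>d. rank_one a (d *\<^sub>R \<alpha>)) ` range (\<lambda>k. c ^ Suc k) \<subseteq> Q"
    using k by blast
  ultimately have "finite (range (\<lambda>k. c ^ Suc k))"
    using finite_Q by (meson finite_imageD finite_subset inj_on_subset subset_UNIV)
  then show ?thesis using finite_real_powers[of c] by (simp add: c_def inner_commute)
qed

text \<open>Applying \<open>rank_one w \<theta>\<close> after \<open>rank_one a \<phi>\<close> keeps
  a and replaces \<phi> by a multiple of \<theta>. In \<open>V_step\<close> it is \<alpha> that is
  kept.\<close>

lemma \<Phi>_step:
  assumes "\<phi> \<in> \<Phi>" "(w, \<theta>) \<in> P" "w \<bullet> \<phi> \<noteq> 0"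
  shows "(w \<bullet> \<phi>) *\<^sub>R \<theta> \<in> \<Phi>"
  using Q_comp[OF Q_gen[OF assms(2)], of "rank_one a \<phi>"] assms unit[OF assms(2)]
  by (auto simp: \<Phi>_def rank_one_comp)

lemma V_step:
  assumes "v \<in> V" "(w, \<theta>) \<in> P" "v \<bullet> \<theta> \<noteq> 0"
  shows "(v \<bullet> \<theta>) *\<^sub>R w \<in> V"
  using Q_comp[of "rank_one v \<alpha>" "rank_one w \<theta>"] Q_gen[OF assms(2)] assms unit[OF assms(2)]
  by (auto simp: V_def rank_one_comp rank_one_scale)

text \<open>The common kernel W of \<Phi> is invariant: if w lies outside W, then
  \<open>\<Phi>_step\<close> puts a multiple of \<theta> into \<Phi>, so \<theta> annihilates W. It
  is not everything, because \<alpha> does not annihilate a.\<close>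

lemma \<Phi>_separates:
  assumes "\<And>\<phi>. \<phi> \<in> \<Phi> \<Longrightarrow> \<phi> \<bullet> x = 0"
  shows "x = 0"
proof -
  define W where "W = {x. \<forall>\<phi>\<in>\<Phi>. \<phi> \<bullet> x = 0}"
  have "W = {0} \<or> W = UNIV"
  proof (rule irreducible)
    show "subspace W" by (auto simp: subspace_def W_def inner_add_right)
    fix w \<theta> assume P: "(w, \<theta>) \<in> P"
    show "w \<in> W \<or> (\<forall>x\<in>W. \<theta> \<bullet> x = 0)"
    proof (cases "w \<in> W")
      case False
      then obtain \<phi> where \<phi>: "\<phi> \<in> \<Phi>" "w \<bullet> \<phi> \<noteq> 0" by (auto simp: W_def inner_commute)
      from \<Phi>_step[OF this(1) P this(2)] have "\<forall>x\<in>W. ((w \<bullet> \<phi>) *\<^sub>R \<theta>) \<bullet> x = 0" unfolding W_def by blast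
      then show ?thesis using \<phi>(2) by simp
    qed blast
  qed
  moreover have "a \<notin> W"
  proof
    assume "a \<in> W"
    then have "\<alpha> \<bullet> a = 0" using base_mem(1) unfolding W_def by blast
    then show False using a\<alpha> by simp
  qed
  moreover have "x \<in> W" using assms by (auto simp: W_def)
  ultimately show ?thesis by blast
qed

lemma span_\<Phi>: "span \<Phi> = UNIV"
proof (rule ccontr)
  assume "span \<Phi> \<noteq> UNIV"
  then obtain x where "x \<noteq> 0" "\<forall>\<phi>\<in>span \<Phi>. x \<bullet> \<phi> = 0"
    using span_not_UNIV_orthogonal by blast
  then show False using \<Phi>_separates[of x] span_base by (metis inner_commute)
qed

lemma span_V: "span V = UNIV"
proof -
  have "span V = {0} \<or> span V = UNIV"
  proof (rule irreducible)
    fix w \<theta> assume P: "(w, \<theta>) \<in> P"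
    show "w \<in> span V \<or> (\<forall>x\<in>span V. \<theta> \<bullet> x = 0)"
    proof (cases "\<exists>v\<in>V. v \<bullet> \<theta> \<noteq> 0")
      case True
      then obtain v where v: "v \<in> V" "v \<bullet> \<theta> \<noteq> 0" by blast
      have "(1 / (v \<bullet> \<theta>)) *\<^sub>R ((v \<bullet> \<theta>) *\<^sub>R w) \<in> span V"
        by (intro span_scale span_base V_step[OF v(1) P v(2)])
      then show ?thesis using v(2) by simp
    next
      case False
      then have "span V \<subseteq> {x. \<theta> \<bullet> x = 0}"
        by (intro span_minimal) (auto simp: subspace_def inner_add_right inner_commute)
      then show ?thesis by blast
    qed
  qed simp
  moreover have "a \<in> span V" using base_mem span_base by blast
  ultimately show ?thesis using a\<alpha> by blast
qed

lemma generator_scaled: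
  assumes P: "(w, \<theta>) \<in> P"
  obtains c d where "c \<noteq> 0" "d \<noteq> 0" "c *\<^sub>R \<theta> \<in> \<Phi>" "d *\<^sub>R w \<in> V"
proof -
  have "w \<noteq> 0" "\<theta> \<noteq> 0" using unit[OF P] by auto
  moreover obtain \<phi> where "\<phi> \<in> \<Phi>" "w \<bullet> \<phi> \<noteq> 0"
    using \<Phi>_separates[of w] \<open>w \<noteq> 0\<close> by (metis inner_commute)
  moreover obtain v where "v \<in> V" "v \<bullet> \<theta> \<noteq> 0"
    using orthogonal_to_span_UNIV[OF span_V, of \<theta>] \<open>\<theta> \<noteq> 0\<close> by blast
  ultimately show ?thesis using that \<Phi>_step[OF _ P] V_step[OF _ P] by blast
qed

text \<open>The idempotent power of an element with cofactor map \<open>x \<mapsto> (v \<bullet> x) \<phi>\<close>.\<close>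

lemma elem_proj_mem:
  assumes "\<phi> \<in> \<Phi>" "v \<in> V" "\<phi> \<bullet> v \<noteq> 0"
  shows "elem_proj v \<phi> \<in> M"
proof -
  \<comment> \<open>Composing through the base pair joins \<phi> and v without a scalar, since
    \<open>a \<bullet> \<alpha> = 1\<close>.\<close>
  have "rank_one v \<phi> \<in> Q"
    using Q_comp[of "rank_one a \<phi>" "rank_one v \<alpha>"] assms by (simp add: rank_one_comp a\<alpha> \<Phi>_def V_def)
  then obtain m where m: "m \<in> M" "cofactor m = rank_one v \<phi>" unfolding Q_def by (metis imageE)
  obtain k where k: "k > 0" "(m ^^ k) \<circ> (m ^^ k) = m ^^ k"
    by (rule finite_powers_idempotent[OF fin m(1) comp])
  \<comment> \<open>Taking powers only rescales \<phi> by a nonzero factor, so the idempotent power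
    still has the lines of v and \<phi>.\<close>
  have pow: "m ^^ Suc j \<in> M \<and> cofactor (m ^^ Suc j) = rank_one v ((v \<bullet> \<phi>) ^ j *\<^sub>R \<phi>)" for j
  proof (induction j)
    case (Suc j)
    have "cofactor (m \<circ> m ^^ Suc j) = rank_one v \<phi> \<circ> rank_one v ((v \<bullet> \<phi>) ^ j *\<^sub>R \<phi>)"
      using cofactor_comp[OF lin[OF m(1)] lin[OF conjunct1[OF Suc]]] conjunct2[OF Suc] m(2) by (simp only:)
    then have "cofactor (m \<circ> m ^^ Suc j) = rank_one v ((v \<bullet> \<phi>) ^ Suc j *\<^sub>R \<phi>)"
      by (simp add: rank_one_comp mult_ac)
    moreover have "m \<circ> m ^^ Suc j \<in> M" using comp[OF m(1)] Suc by blast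
    ultimately show ?case by (simp only: funpow.simps(2)[of "Suc j"])
  qed (use m in simp)
  obtain j where j: "k = Suc j" using k(1) by (cases k) auto
  define d where "d = (v \<bullet> \<phi>) ^ j"
  have d: "d \<noteq> 0" using assms(3) by (simp add: d_def inner_commute)
  have "m ^^ k = elem_proj v (d *\<^sub>R \<phi>)"
    using idempotent_cofactor_rank_one[of "m ^^ k" v "d *\<^sub>R \<phi>"] pow[of j] lin k(2) d assms(3)
    unfolding j d_def by simp
  also have "\<dots> = elem_proj v \<phi>" using elem_proj_scale[of 1 d v \<phi>] d by simp
  finally show ?thesis using pow[of j] j by simp
qed

section \<open>Patterns excluded by finiteness\<close>

lemma par_if_scaled_\<Phi>: "\<lbrakk>\<phi> \<in> \<Phi>; \<psi> \<in> \<Phi>; \<phi> = c *\<^sub>R \<psi>\<rbrakk> \<Longrightarrow> par \<phi> \<psi>"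
proof -
  assume *: "\<phi> \<in> \<Phi>" "\<psi> \<in> \<Phi>" "\<phi> = c *\<^sub>R \<psi>"
  then have "\<phi> \<noteq> 0" by (simp add: \<Phi>_def)
  then obtain v where v: "v \<in> V" "v \<bullet> \<phi> \<noteq> 0"
    using orthogonal_to_span_UNIV[OF span_V] by blast
  then have "c = 1 \<or> c = -1"
    using vals[OF *(1) v(1)] vals[OF *(2) v(1)] *(3) by (auto simp: inner_commute)
  then show ?thesis using *(3) by (auto simp: par_def)
qed

lemma par_if_scaled_V: "\<lbrakk>v \<in> V; w \<in> V; v = c *\<^sub>R w\<rbrakk> \<Longrightarrow> par v w"
proof -
  assume *: "v \<in> V" "w \<in> V" "v = c *\<^sub>R w"
  then have "v \<noteq> 0" by (simp add: V_def)
  then obtain \<phi> where \<phi>: "\<phi> \<in> \<Phi>" "\<phi> \<bullet> v \<noteq> 0"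
    using \<Phi>_separates by blast
  then have "c = 1 \<or> c = -1"
    using vals[OF \<phi>(1) *(1)] vals[OF \<phi>(1) *(2)] *(3) by auto
  then show ?thesis using *(3) by (auto simp: par_def)
qed

text \<open>The projections for the diagonal pairs lie in M, so \<open>block_product\<close>
  excludes a vanishing determinant. With entries 1 and -1 the two diagonal products are then
  opposite.\<close>

lemma block:
  assumes mem: "\<phi> \<in> \<Phi>" "\<psi> \<in> \<Phi>" "v \<in> V" "w \<in> V" and np: "\<not> par \<phi> \<psi>" "\<not> par v w"
    and nz: "\<phi> \<bullet> v \<noteq> 0" "\<phi> \<bullet> w \<noteq> 0" "\<psi> \<bullet> v \<noteq> 0" "\<psi> \<bullet> w \<noteq> 0"
  shows "(\<phi> \<bullet> v) * (\<phi> \<bullet> w) * (\<psi> \<bullet> v) * (\<psi> \<bullet> w) = -1"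
proof -
  have "(\<phi> \<bullet> v) * (\<psi> \<bullet> w) \<noteq> (\<phi> \<bullet> w) * (\<psi> \<bullet> v)"
    using block_product[OF elem_proj_mem elem_proj_mem, of \<phi> v \<psi> w] mem np nz
      par_if_scaled_\<Phi> par_if_scaled_V by blast
  then show ?thesis
    using vals[of \<phi> v] vals[of \<phi> w] vals[of \<psi> v] vals[of \<psi> w] mem nz by auto
qed

lemma no_hook:
  assumes mem: "\<phi>\<^sub>1 \<in> \<Phi>" "\<phi>\<^sub>2 \<in> \<Phi>" "\<phi>\<^sub>3 \<in> \<Phi>" "v\<^sub>1 \<in> V" "v\<^sub>2 \<in> V" "v\<^sub>3 \<in> V"
    and nz: "\<phi>\<^sub>1 \<bullet> v\<^sub>1 \<noteq> 0" "\<phi>\<^sub>1 \<bullet> v\<^sub>2 \<noteq> 0" "\<phi>\<^sub>2 \<bullet> v\<^sub>1 \<noteq> 0" "\<phi>\<^sub>2 \<bullet> v\<^sub>2 \<noteq> 0"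
    and h: "\<phi>\<^sub>1 \<bullet> v\<^sub>3 \<noteq> 0" "\<phi>\<^sub>2 \<bullet> v\<^sub>3 = 0" "\<phi>\<^sub>3 \<bullet> v\<^sub>1 \<noteq> 0" "\<phi>\<^sub>3 \<bullet> v\<^sub>2 = 0"
  shows False
proof -
  define A B C D E F G where "A = \<phi>\<^sub>1 \<bullet> v\<^sub>1" and "B = \<phi>\<^sub>1 \<bullet> v\<^sub>2" and "C = \<phi>\<^sub>2 \<bullet> v\<^sub>1" and "D = \<phi>\<^sub>2 \<bullet> v\<^sub>2"
    and "E = \<phi>\<^sub>1 \<bullet> v\<^sub>3" and "F = \<phi>\<^sub>3 \<bullet> v\<^sub>1" and "G = \<phi>\<^sub>3 \<bullet> v\<^sub>3"
  note defs = A_def[symmetric] B_def[symmetric] C_def[symmetric] D_def[symmetric] E_def[symmetric]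
    F_def[symmetric] G_def[symmetric]
  have nz': "A \<noteq> 0" "B \<noteq> 0" "C \<noteq> 0" "D \<noteq> 0" "E \<noteq> 0" "F \<noteq> 0" using nz h unfolding defs by auto
  have pm: "A \<in> {-1, 1}" "B \<in> {-1, 1}" "C \<in> {-1, 1}" "D \<in> {-1, 1}" "E \<in> {-1, 1}" "F \<in> {-1, 1}"
    "G \<in> {-1, 0, 1}"
    using vals[OF mem(1,4)] vals[OF mem(1,5)] vals[OF mem(2,4)] vals[OF mem(2,5)] vals[OF mem(1,6)]
      vals[OF mem(3,4)] vals[OF mem(3,6)] nz' unfolding defs by auto
  have np: "\<not> par \<phi>\<^sub>1 \<phi>\<^sub>2" "\<not> par v\<^sub>1 v\<^sub>2" "\<not> par \<phi>\<^sub>1 \<phi>\<^sub>3" "\<not> par v\<^sub>1 v\<^sub>3"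
    using nz h by (auto simp: par_def)
  have ABCD: "A * B * C * D = -1"
    using block[OF mem(1,2,4,5) np(1,2) nz] unfolding defs .
  have AEFG: "A * E * F * G = -1" if "G \<noteq> 0"
    using block[OF mem(1,3,4,6) np(3,4) nz(1) h(1,3)] that unfolding defs by simp
  have AD: "A * D / (B * C) = -1"
    using ABCD pm(2,3) by auto
  \<comment> \<open>A line, since \<open>\<phi>\<^sub>1\<close> and \<open>\<phi>\<^sub>3\<close>
    are not parallel. Both words below preserve it: the factor applied last maps into the kernel of
    \<open>\<phi>\<^sub>1\<close> and, as \<open>\<phi>\<^sub>3 \<bullet> v\<^sub>2 = 0\<close>,
    does not disturb \<open>\<phi>\<^sub>3\<close>, which the factor before it has made
    zero.\<close>
  define X where "X = {x. \<phi>\<^sub>1 \<bullet> x = 0 \<and> \<phi>\<^sub>3 \<bullet> x = 0}"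
  have p12: "elem_proj v\<^sub>2 \<phi>\<^sub>1 \<in> M" and p21: "elem_proj v\<^sub>1 \<phi>\<^sub>2 \<in> M" and p31: "elem_proj v\<^sub>1 \<phi>\<^sub>3 \<in> M"
    and p13: "elem_proj v\<^sub>3 \<phi>\<^sub>1 \<in> M"
    using elem_proj_mem mem nz h by blast+
  have inner_proj: "\<psi> \<bullet> elem_proj v \<phi> x = \<psi> \<bullet> x - (\<phi> \<bullet> x) / (\<phi> \<bullet> v) * (\<psi> \<bullet> v)" for \<psi> \<phi> v x
    by (simp add: elem_proj_def inner_diff_right)
  show False
  proof (cases "G = 0")
    case True
    \<comment> \<open>This word, and the one for \<open>G \<noteq> 0\<close>, come from a search through short words: they have eigenvalue \<open>\<plusminus> 2\<close>.\<close>
    define m where "m = elem_proj v\<^sub>2 \<phi>\<^sub>1 \<circ> (elem_proj v\<^sub>1 \<phi>\<^sub>3 \<circ> (elem_proj v\<^sub>3 \<phi>\<^sub>1 \<circ> elem_proj v\<^sub>1 \<phi>\<^sub>2))"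
    \<comment> \<open>The ratio cancels the value of \<open>\<phi>\<^sub>1\<close>; both summands
      are annihilated by \<open>\<phi>\<^sub>3\<close> because \<open>G = 0\<close>.\<close>
    define x where "x = v\<^sub>2 - (B / E) *\<^sub>R v\<^sub>3"
    have m: "m \<in> M" unfolding m_def by (intro comp p12 p31 p13 p21)
    have x: "x \<in> X" "\<phi>\<^sub>2 \<bullet> x \<noteq> 0"
      using True nz' h by (simp_all add: X_def x_def inner_diff_right defs)
    have "m y \<in> X \<and> \<phi>\<^sub>2 \<bullet> m y = 2 * (\<phi>\<^sub>2 \<bullet> y)" if "y \<in> X" for y
    proof -
      define t y\<^sub>1 y\<^sub>2 y\<^sub>3 where "t = \<phi>\<^sub>2 \<bullet> y" and "y\<^sub>1 = elem_proj v\<^sub>1 \<phi>\<^sub>2 y"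
        and "y\<^sub>2 = elem_proj v\<^sub>3 \<phi>\<^sub>1 y\<^sub>1" and "y\<^sub>3 = elem_proj v\<^sub>1 \<phi>\<^sub>3 y\<^sub>2"
      note ys = y\<^sub>1_def y\<^sub>2_def y\<^sub>3_def
      have y: "\<phi>\<^sub>1 \<bullet> y = 0" "\<phi>\<^sub>3 \<bullet> y = 0" "\<phi>\<^sub>2 \<bullet> y = t" using that by (simp_all add: X_def t_def)
      have 1: "\<phi>\<^sub>1 \<bullet> y\<^sub>1 = - (t / C * A)" "\<phi>\<^sub>2 \<bullet> y\<^sub>1 = 0" "\<phi>\<^sub>3 \<bullet> y\<^sub>1 = - (t / C * F)"
        using nz' by (simp_all add: ys inner_proj y defs)
      have 2: "\<phi>\<^sub>1 \<bullet> y\<^sub>2 = 0" "\<phi>\<^sub>2 \<bullet> y\<^sub>2 = 0" "\<phi>\<^sub>3 \<bullet> y\<^sub>2 = - (t / C * F)"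
        using nz' h True by (simp_all add: y\<^sub>2_def inner_proj 1 defs)
      have 3: "\<phi>\<^sub>1 \<bullet> y\<^sub>3 = t / C * A" "\<phi>\<^sub>2 \<bullet> y\<^sub>3 = t" "\<phi>\<^sub>3 \<bullet> y\<^sub>3 = 0"
        using nz' by (simp_all add: y\<^sub>3_def inner_proj 2 defs)
      have "m y = elem_proj v\<^sub>2 \<phi>\<^sub>1 y\<^sub>3" by (simp add: m_def ys)
      then have 4: "\<phi>\<^sub>1 \<bullet> m y = 0" "\<phi>\<^sub>2 \<bullet> m y = t - t * (A * D / (B * C))" "\<phi>\<^sub>3 \<bullet> m y = 0"
        using nz' h by (simp_all add: inner_proj 3 defs mult_ac)
      then show ?thesis unfolding AD X_def y by simp
    qed
    then show False using no_expansion[OF m x, of 2] by auto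
  next
    case False
    then have p33: "elem_proj v\<^sub>3 \<phi>\<^sub>3 \<in> M" using elem_proj_mem[OF mem(3,6)] by (simp add: G_def)
    define m where "m = elem_proj v\<^sub>2 \<phi>\<^sub>1 \<circ> (elem_proj v\<^sub>3 \<phi>\<^sub>3 \<circ> elem_proj v\<^sub>1 \<phi>\<^sub>2)"
    \<comment> \<open>The multiple of \<open>v\<^sub>3\<close> cancels the value of
      \<open>\<phi>\<^sub>3\<close> at \<open>v\<^sub>1\<close>; the multiple of
      \<open>v\<^sub>2\<close>, invisible to \<open>\<phi>\<^sub>3\<close>, then cancels that of
      \<open>\<phi>\<^sub>1\<close>.\<close>
    define x where "x = v\<^sub>1 - (F / G) *\<^sub>R v\<^sub>3 - ((A - F * E / G) / B) *\<^sub>R v\<^sub>2"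
    have m: "m \<in> M" unfolding m_def by (intro comp p12 p33 p21)
    \<comment> \<open>The block condition for rows 1, 3 and columns 1, 3. It makes
      \<open>A - F * E / G\<close> equal to \<open>2 * A\<close>, the source of the factor
      2.\<close>
    have EF: "F * E / G = - A"
    proof -
      have "F * E * G = - A" using AEFG[OF False] pm(1) by (auto simp: mult.commute)
      then show ?thesis using pm(7) False by auto
    qed
    have "\<phi>\<^sub>2 \<bullet> x = C - (A + A) * D / B"
      using h unfolding x_def EF by (simp add: inner_diff_right defs)
    also have "\<dots> = C - 2 * C * (A * D / (B * C))" using nz' by (simp add: field_simps)
    also have "\<dots> = 3 * C" unfolding AD by simp
    finally have x2: "\<phi>\<^sub>2 \<bullet> x \<noteq> 0" using nz' by simp
    have x: "x \<in> X"
      using False nz' h by (simp add: X_def x_def inner_diff_right defs)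
    have "m y \<in> X \<and> \<phi>\<^sub>2 \<bullet> m y = (- 2) * (\<phi>\<^sub>2 \<bullet> y)" if "y \<in> X" for y
    proof -
      define t y\<^sub>1 y\<^sub>2 where "t = \<phi>\<^sub>2 \<bullet> y" and "y\<^sub>1 = elem_proj v\<^sub>1 \<phi>\<^sub>2 y" and "y\<^sub>2 = elem_proj v\<^sub>3 \<phi>\<^sub>3 y\<^sub>1"
      note ys = y\<^sub>1_def y\<^sub>2_def
      have y: "\<phi>\<^sub>1 \<bullet> y = 0" "\<phi>\<^sub>3 \<bullet> y = 0" "\<phi>\<^sub>2 \<bullet> y = t" using that by (simp_all add: X_def t_def)
      have 1: "\<phi>\<^sub>1 \<bullet> y\<^sub>1 = - (t / C * A)" "\<phi>\<^sub>2 \<bullet> y\<^sub>1 = 0" "\<phi>\<^sub>3 \<bullet> y\<^sub>1 = - (t / C * F)"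
        using nz' by (simp_all add: ys inner_proj y defs)
      have "\<phi>\<^sub>1 \<bullet> y\<^sub>2 = - (t / C * A) + t / C * (F * E / G)" "\<phi>\<^sub>2 \<bullet> y\<^sub>2 = 0" "\<phi>\<^sub>3 \<bullet> y\<^sub>2 = 0"
        using False h by (simp_all add: y\<^sub>2_def inner_proj 1 defs)
      then have 2: "\<phi>\<^sub>1 \<bullet> y\<^sub>2 = - 2 * (t / C * A)" "\<phi>\<^sub>2 \<bullet> y\<^sub>2 = 0" "\<phi>\<^sub>3 \<bullet> y\<^sub>2 = 0"
        unfolding EF by simp_all
      have "m y = elem_proj v\<^sub>2 \<phi>\<^sub>1 y\<^sub>2" by (simp add: m_def ys)
      then have 4: "\<phi>\<^sub>1 \<bullet> m y = 0" "\<phi>\<^sub>2 \<bullet> m y = 2 * t * (A * D / (B * C))" "\<phi>\<^sub>3 \<bullet> m y = 0"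
        using nz' h by (simp_all add: inner_proj 2 defs mult_ac)
      then show ?thesis unfolding AD X_def y by simp
    qed
    then show False using no_expansion[OF m x x2, of "- 2"] by auto
  qed
qed

sublocale config: dual_config \<Phi> V
proof
  show "0 \<notin> \<Phi>" "0 \<notin> V" by (auto simp: \<Phi>_def V_def)
  fix S T assume ST: "S \<subseteq> \<Phi>" "T \<subseteq> V" "S \<noteq> {} \<or> T \<noteq> {}"
    and iff: "\<And>\<phi> v. \<lbrakk>\<phi> \<in> \<Phi>; v \<in> V; \<phi> \<bullet> v \<noteq> 0\<rbrakk> \<Longrightarrow> \<phi> \<in> S \<longleftrightarrow> v \<in> T"
  have nz: "v \<in> V \<Longrightarrow> \<exists>\<phi>\<in>\<Phi>. \<phi> \<bullet> v \<noteq> 0" for v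
    using \<Phi>_separates[of v] by (auto simp: V_def)
  have nz': "\<phi> \<in> \<Phi> \<Longrightarrow> \<exists>v\<in>V. \<phi> \<bullet> v \<noteq> 0" for \<phi>
    using orthogonal_to_span_UNIV[OF span_V, of \<phi>] by (auto simp: \<Phi>_def inner_commute)
  \<comment> \<open>The two representatives of a generator pair to a nonzero entry, so they lie in S
    and T together or not at all. Either w is in the span of T or \<theta> annihilates T, and the
    span is invariant.\<close>
  have "span T = {0} \<or> span T = UNIV"
  proof (rule irreducible)
    fix w \<theta> assume P: "(w, \<theta>) \<in> P"
    obtain c d where cd: "c \<noteq> 0" "d \<noteq> 0" "c *\<^sub>R \<theta> \<in> \<Phi>" "d *\<^sub>R w \<in> V"
      by (rule generator_scaled[OF P])
    have e: "c *\<^sub>R \<theta> \<in> S \<longleftrightarrow> d *\<^sub>R w \<in> T"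
      using iff[OF cd(3,4)] cd(1,2) unit[OF P] by simp
    show "w \<in> span T \<or> (\<forall>x\<in>span T. \<theta> \<bullet> x = 0)"
    proof (cases "d *\<^sub>R w \<in> T")
      case True
      then have "(1 / d) *\<^sub>R (d *\<^sub>R w) \<in> span T" by (intro span_scale span_base)
      then show ?thesis using cd(2) by simp
    next
      case False
      have "\<theta> \<bullet> t = 0" if "t \<in> T" for t
        using iff[OF cd(3), of t] that ST(2) False e cd(1) by auto
      then have "span T \<subseteq> {x. \<theta> \<bullet> x = 0}"
        by (intro span_minimal) (auto simp: subspace_def inner_add_right)
      then show ?thesis by blast
    qed
  qed simp
  then show "S = \<Phi> \<and> T = V"
  proof
    assume "span T = {0}"
    then have "T = {}" using ST(2) span_base[of _ T] by (fastforce simp: V_def)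
    moreover from this have "S = {}" using nz' iff ST(1) by blast
    ultimately show ?thesis using ST(3) by blast
  next
    assume T: "span T = UNIV"
    have "\<phi> \<in> S" if "\<phi> \<in> \<Phi>" for \<phi>
      using orthogonal_to_span_UNIV[OF T, of \<phi>] that iff[OF that] ST(2)
      by (auto simp: \<Phi>_def inner_commute)
    then have "S = \<Phi>" using ST(1) by blast
    moreover have "T = V" using nz iff ST(2) \<open>S = \<Phi>\<close> by blast
    ultimately show ?thesis by blast
  qed
qed (fact vals span_\<Phi> span_V block | use no_hook in blast)+

end

section \<open>The monoids of types A and B\<close>

lemma carrier_End_UNIV: "m \<in> carrier (End_monoid UNIV) \<longleftrightarrow> linear m"
  by (auto simp: End_monoid_def linear_between_def linear_iff)

lemma compose_UNIV: "compose UNIV m n = m \<circ> n"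
  by (simp add: compose_def fun_eq_iff)

lemma End_UNIV_simps:
  "m \<otimes>\<^bsub>End_monoid UNIV\<^esub> n = m \<circ> n" "\<one>\<^bsub>End_monoid UNIV\<^esub> = id"
  by (simp_all add: End_monoid_def compose_UNIV fun_eq_iff)

lemma generated_monoid_linear:
  assumes "m \<in> generated_monoid UNIV R" "\<And>r. r \<in> R \<Longrightarrow> linear r"
  shows "linear m"
  using assms
  by (induction rule: generated_monoid.induct) (auto simp: End_UNIV_simps linear_id intro: linear_compose)

lemma generated_monoid_carrier:
  assumes "subspace W" "G \<subseteq> carrier (End_monoid W)"
  shows "generated_monoid W G \<subseteq> carrier (End_monoid W)"
proof
  fix m assume "m \<in> generated_monoid W G"
  then show "m \<in> carrier (End_monoid W)"
  proof induction
    case one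
    show ?case using assms(1)
      by (auto simp: End_monoid_def linear_between_def subspace_add subspace_scale extensional_def)
  next
    case (gen p)
    then show ?case using assms(2) by blast
  next
    case (mult m n)
    then show ?case using assms(1)
      by (auto simp: End_monoid_def linear_between_def compose_def subspace_add subspace_scale Pi_iff extensional_def)
  qed
qed

text \<open>Conjugation by f respects products and the identity, so matching each element of R with
  one of G suffices. The conjugates are restricted to W because elements of
  \<open>End_monoid W\<close> are extensional.\<close>

lemma equivalent_to_generated_monoid:
  fixes f :: "'a::real_vector \<Rightarrow> 'b::real_vector"
  assumes lin: "linear f" and bij: "bij_betw f UNIV W" and W: "subspace W"
    and G: "G \<subseteq> carrier (End_monoid W)"
    and RG: "\<And>r. r \<in> R \<Longrightarrow> \<exists>g\<in>G. \<forall>x. g (f x) = f (r x)"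
  shows "equivalent_to_submonoid UNIV (generated_monoid UNIV R) W (generated_monoid W G)"
proof -
  define c where "c m = (\<lambda>y\<in>W. f (m (inv_into UNIV f y)))" for m
  have f: "f x \<in> W" "inv_into UNIV f (f x) = x" for x
    using bij by (auto simp: bij_betw_def)
  have onto: "\<exists>x. y = f x" if "y \<in> W" for y using that bij by (auto simp: bij_betw_def)
  have cI: "c m = g" if "g \<in> extensional W" "\<And>x. g (f x) = f (m x)" for m g
  proof (rule extensionalityI[of _ W])
    fix y assume "y \<in> W"
    then obtain x where "y = f x" using onto by blast
    then show "c m y = g y" by (simp add: c_def f that(2))
  qed (simp_all add: c_def that(1))
  have c_one: "c id = \<one>\<^bsub>End_monoid W\<^esub>"
    by (rule cI) (simp_all add: End_monoid_def f)
  have c_mult: "c (m \<circ> n) = c m \<otimes>\<^bsub>End_monoid W\<^esub> c n" for m n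
    by (rule cI) (simp_all add: End_monoid_def f c_def compose_def)
  have sub: "c m \<in> generated_monoid W G" if "m \<in> generated_monoid UNIV R" for m
    using that
  proof induction
    case one
    then show ?case using generated_monoid.one[of W G] by (simp only: End_UNIV_simps c_one)
  next
    case (gen r)
    then obtain g where g: "g \<in> G" "\<forall>x. g (f x) = f (r x)" using RG by blast
    then have "g \<in> extensional W" using G by (auto simp: End_monoid_def)
    then have "c r = g" using g(2) by (intro cI) auto
    then show ?case using generated_monoid.gen[OF g(1)] by simp
  next
    case (mult m n)
    then show ?case using generated_monoid.mult[of "c m" W G "c n"] by (simp only: End_UNIV_simps c_mult)
  qed
  define N where "N = c ` generated_monoid UNIV R"
  have "submonoid N (End_monoid W)"
  proof
    show "N \<subseteq> carrier (End_monoid W)"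
      using sub generated_monoid_carrier[OF W G] by (auto simp: N_def)
    show "x \<otimes>\<^bsub>End_monoid W\<^esub> y \<in> N" if xy: "x \<in> N" "y \<in> N" for x y
    proof -
      obtain m n where mn: "x = c m" "y = c n" "m \<in> generated_monoid UNIV R" "n \<in> generated_monoid UNIV R"
        using xy by (auto simp: N_def)
      have "m \<circ> n \<in> generated_monoid UNIV R"
        using generated_monoid.mult[OF mn(3,4)] by (simp only: End_UNIV_simps)
      then show ?thesis unfolding mn c_mult[symmetric] N_def by blast
    qed
    show "\<one>\<^bsub>End_monoid W\<^esub> \<in> N"
      using generated_monoid.one[of UNIV R] unfolding End_UNIV_simps c_one[symmetric] N_def by blast
  qed
  moreover have "N \<subseteq> generated_monoid W G" using sub by (auto simp: N_def)
  moreover have "equivalent_monoids UNIV (generated_monoid UNIV R) W N"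
    unfolding equivalent_monoids_def
    using lin bij f by (intro exI[of _ f]) (auto simp: linear_between_def linear_iff N_def c_def[abs_def])
  ultimately show ?thesis unfolding equivalent_to_submonoid_def by blast
qed

text \<open>The shape that the generators of both types take in coordinates;
  \<open>d $ i = 1\<close> is what makes the map idempotent.\<close>

lemma coordinate_projection:
  fixes W :: "(real ^ 'n) set"
  assumes W: "subspace W" and d: "d \<in> W" "d $ i = 1"
  shows "projection_along W (span {d}) {z \<in> W. z $ i = 0} (\<lambda>z\<in>W. z - z $ i *\<^sub>R d)"
proof -
  let ?p = "\<lambda>z\<in>W. z - z $ i *\<^sub>R d"
  have mem: "z - z $ i *\<^sub>R d \<in> W" if "z \<in> W" for z
    using that W d by (intro subspace_diff subspace_scale)
  have "?p \<in> carrier (End_monoid W)"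
    using W mem by (auto simp: End_monoid_def linear_between_def subspace_add subspace_scale algebra_simps)
  moreover have "compose W ?p ?p = ?p"
    using mem d by (auto simp: compose_def fun_eq_iff restrict_def)
  moreover have ker: "kernel_on W ?p = span {d}"
    using W d by (auto simp: kernel_on_def span_singleton subspace_scale)
  moreover have "dim (span {d}) = 1"
    using d(2) by (auto simp: dim_span)
  moreover have "?p ` W = {z \<in> W. z $ i = 0}"
  proof
    show "?p ` W \<subseteq> {z \<in> W. z $ i = 0}"
      using mem d(2) by (simp add: image_subset_iff)
    show "{z \<in> W. z $ i = 0} \<subseteq> ?p ` W"
    proof
      fix z assume "z \<in> {z \<in> W. z $ i = 0}"
      then show "z \<in> ?p ` W" by (intro image_eqI[of _ _ z]) auto
    qed
  qed
  ultimately show ?thesis unfolding projection_along_def is_projection_def by simp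
qed

lemma vec_expansion: "z = (\<Sum>k\<in>UNIV. z $ k *\<^sub>R axis k 1)" for z :: "real ^ 'n"
  using basis_expansion[of z] by (simp add: scalar_mult_eq_scaleR)

lemma zero_sum_expansion:
  fixes z :: "real ^ 'n"
  assumes "(\<Sum>k\<in>UNIV. z $ k) = 0"
  shows "z = (\<Sum>k\<in>UNIV. z $ k *\<^sub>R (axis k 1 - axis j 1))"
proof -
  have "(\<Sum>k\<in>UNIV. z $ k *\<^sub>R (axis k 1 - axis j 1)) = z - (\<Sum>k\<in>UNIV. z $ k) *\<^sub>R (axis j 1 :: real ^ 'n)"
    by (simp only: scaleR_right_diff_distrib sum_subtractf scaleR_sum_left vec_expansion[symmetric])
  then show ?thesis by (simp add: assms)
qed

lemma sum_axis_diff: "(\<Sum>k\<in>UNIV. (axis i 1 - axis j 1 :: real ^ 'n) $ k) = 0"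
  by (simp add: sum_subtractf axis_def)

lemma A3_space_eq: "A3_space = {z. (\<Sum>k\<in>UNIV. z $ k) = 0}"
proof
  have "subspace {z :: real ^ 4. (\<Sum>k\<in>UNIV. z $ k) = 0}"
    by (auto simp: subspace_def sum.distrib sum_distrib_left[symmetric])
  then show "A3_space \<subseteq> {z. (\<Sum>k\<in>UNIV. z $ k) = 0}"
    unfolding A3_space_def using sum_axis_diff by (intro span_minimal) blast+
  show "{z. (\<Sum>k\<in>UNIV. z $ k) = 0} \<subseteq> A3_space"
  proof
    fix z :: "real ^ 4" assume "z \<in> {z. (\<Sum>k\<in>UNIV. z $ k) = 0}"
    then have "z = (\<Sum>k\<in>UNIV. z $ k *\<^sub>R (axis k 1 - axis 1 1))" by (intro zero_sum_expansion) simp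
    also have "\<dots> \<in> A3_space"
      unfolding A3_space_def by (intro span_sum span_scale span_base) blast
    finally show "z \<in> A3_space" .
  qed
qed

lemma subspace_A3_space: "subspace A3_space"
  unfolding A3_space_def by (rule subspace_span)

lemma A3_generator:
  assumes "i \<noteq> j"
  shows "(\<lambda>z\<in>A3_space. z - z $ i *\<^sub>R (axis i 1 - axis j 1)) \<in> A3_generators"
proof -
  have "{z \<in> A3_space. z $ i = 0} = span {axis k 1 - axis l 1 | k l. k \<noteq> i \<and> l \<noteq> i}" (is "_ = span ?S")
  proof
    show "{z \<in> A3_space. z $ i = 0} \<subseteq> span ?S"
    proof
      fix z assume z: "z \<in> {z \<in> A3_space. z $ i = 0}"
      \<comment> \<open>Differences are taken against j, which is not i, so only the term with k = i
        leaves the spanning set, and its coefficient is zero.\<close>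
      then have "z = (\<Sum>k\<in>UNIV. z $ k *\<^sub>R (axis k 1 - axis j 1))"
        by (intro zero_sum_expansion) (simp add: A3_space_eq)
      also have "\<dots> \<in> span ?S"
      proof (rule span_sum)
        fix k
        show "z $ k *\<^sub>R (axis k 1 - axis j 1) \<in> span ?S"
        proof (cases "k = i")
          case True
          then show ?thesis using z by (simp add: span_zero)
        next
          case False
          then show ?thesis using assms by (intro span_scale span_base) blast
        qed
      qed
      finally show "z \<in> span ?S" .
    qed
    have sub: "subspace {z \<in> A3_space. z $ i = 0}"
      using subspace_A3_space by (auto simp: subspace_def)
    have "axis k 1 - axis l 1 \<in> {z \<in> A3_space. z $ i = 0}" if "k \<noteq> i" "l \<noteq> i" for k l
    proof -
      have "axis k 1 - axis l 1 \<in> A3_space" unfolding A3_space_def by (intro span_base) blast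
      then show ?thesis using that by (simp add: axis_def)
    qed
    then have "?S \<subseteq> {z \<in> A3_space. z $ i = 0}" by blast
    then show "span ?S \<subseteq> {z \<in> A3_space. z $ i = 0}" using sub by (rule span_minimal)
  qed
  moreover have "axis i 1 - axis j 1 \<in> A3_space" unfolding A3_space_def by (intro span_base) blast
  moreover have "(axis i 1 - axis j 1 :: real ^ 4) $ i = 1"
    using assms by (simp add: axis_def)
  ultimately have "projection_along A3_space (span {axis i 1 - axis j 1}) (span ?S)
      (\<lambda>z\<in>A3_space. z - z $ i *\<^sub>R (axis i 1 - axis j 1))"
    using coordinate_projection[OF subspace_A3_space, of "axis i 1 - axis j 1" i] by simp
  then show ?thesis unfolding A3_generators_def using assms by blast
qed

text \<open>One formula for both families: s = 0 gives the projections along a basis vector, s =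
  \<plusminus>1 the signed ones.\<close>

lemma B32_generator:
  assumes "i \<noteq> j" "s \<in> {0, 1, -1}"
  shows "(\<lambda>z. z - z $ i *\<^sub>R (axis i 1 - s *\<^sub>R axis j 1)) \<in> B32_generators"
proof -
  have "{z. z $ i = 0} = span {axis k (1::real) | k. k \<noteq> i}" (is "_ = span ?S")
  proof
    show "{z. z $ i = 0} \<subseteq> span ?S"
    proof
      fix z :: "real ^ 3" assume z: "z \<in> {z. z $ i = 0}"
      have "(\<Sum>k\<in>UNIV. z $ k *\<^sub>R axis k 1) \<in> span ?S"
      proof (rule span_sum)
        fix k
        show "z $ k *\<^sub>R axis k 1 \<in> span ?S"
        proof (cases "k = i")
          case True
          then show ?thesis using z by (simp add: span_zero)
        next
          case False
          then show ?thesis by (intro span_scale span_base) blast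
        qed
      qed
      then show "z \<in> span ?S" by (simp only: vec_expansion[of z, symmetric])
    qed
    show "span ?S \<subseteq> {z. z $ i = 0}"
      by (intro span_minimal) (auto simp: subspace_def axis_def)
  qed
  moreover have "(axis i 1 - s *\<^sub>R axis j 1 :: real ^ 3) $ i = 1"
    using assms by (simp add: axis_def)
  ultimately have p: "projection_along UNIV (span {axis i 1 - s *\<^sub>R axis j 1}) (span ?S)
      (\<lambda>z. z - z $ i *\<^sub>R (axis i 1 - s *\<^sub>R axis j 1))"
    using coordinate_projection[of UNIV "axis i 1 - s *\<^sub>R axis j 1" i] by (simp add: restrict_UNIV)
  show ?thesis
  proof (cases "s = 0")
    case True
    then show ?thesis using p unfolding B32_generators_def by auto
  next
    case False
    then have "s \<in> {1, -1}" using assms(2) by simp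
    then show ?thesis using p assms(1) unfolding B32_generators_def by blast
  qed
qed

lemma dim_A3_space: "dim A3_space = 3"
proof -
  have "A3_space = {z :: real ^ 4. (\<chi> i. 1) \<bullet> z = 0}"
    by (simp add: A3_space_eq inner_vec_def)
  moreover have "((\<chi> i. 1) :: real ^ 4) \<noteq> 0"
    by (simp add: vec_eq_iff)
  ultimately show ?thesis using dim_hyperplane[of "(\<chi> i. 1) :: real ^ 4"] by simp
qed

section \<open>Coordinates with respect to a frame\<close>

lemma linear_coords:
  fixes y :: "'n::finite \<Rightarrow> real ^ 3"
  assumes "linear g"
  shows "linear (\<lambda>x. \<chi> i. y i \<bullet> g x)"
  by (rule linearI)
    (simp_all add: linear_add[OF assms] linear_scale[OF assms] inner_add_right vec_eq_iff)

lemma inj_coords: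
  fixes y :: "'n::finite \<Rightarrow> real ^ 3"
  assumes "span (range y) = UNIV"
  shows "inj (\<lambda>x. \<chi> i. y i \<bullet> x)"
proof (rule injI)
  fix x x' :: "real ^ 3" assume "(\<chi> i. y i \<bullet> x) = (\<chi> i. y i \<bullet> x')"
  then have "y i \<bullet> (x - x') = 0" for i by (simp add: vec_eq_iff inner_diff_right)
  then have "x - x' = 0" by (intro orthogonal_to_span_UNIV[OF assms]) auto
  then show "x = x'" by simp
qed

lemma bij_betw_precompose:
  assumes "bij g" "bij_betw h UNIV W"
  shows "bij_betw (\<lambda>x. h (g x)) UNIV W"
  using bij_betw_trans[of g UNIV UNIV h W] assms by (simp add: comp_def)

text \<open>The map g is the identity for M and \<open>functional_vec\<close> for its dual, so one
  argument serves both. In the coordinates h each element of R becomes a standard generator.\<close>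

lemma balanced_frame_A3:
  fixes g :: "'e::real_vector \<Rightarrow> real ^ 3"
  assumes g: "linear g" "bij g" and y: "balanced_frame \<Phi> V y"
    and R: "\<And>r. r \<in> R \<Longrightarrow> \<exists>\<phi>\<in>\<Phi>. \<exists>v\<in>V. \<phi> \<bullet> v \<noteq> 0 \<and> (\<forall>x. g (r x) = elem_proj v \<phi> (g x))"
  shows "equivalent_to_submonoid UNIV (generated_monoid UNIV R) A3_space A3_monoid"
proof -
  define h where "h u = (\<chi> i. y i \<bullet> u)" for u
  have y0: "(\<Sum>i\<in>UNIV. y i) = 0" and sp: "span (range y) = UNIV"
    and y\<Phi>: "\<phi> \<in> \<Phi> \<Longrightarrow> \<exists>i c. c \<noteq> 0 \<and> \<phi> = c *\<^sub>R y i"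
    and yV: "v \<in> V \<Longrightarrow> \<exists>i j. i \<noteq> j \<and> (\<forall>k. k \<noteq> i \<longrightarrow> k \<noteq> j \<longrightarrow> y k \<bullet> v = 0)" for \<phi> v
    using y unfolding balanced_frame_def by blast+
  have hA: "h u \<in> A3_space" for u
  proof -
    have "(\<Sum>i\<in>UNIV. y i \<bullet> u) = 0" unfolding inner_sum_left[symmetric] y0 by simp
    then show ?thesis by (simp add: A3_space_eq h_def)
  qed
  have lh: "linear h" unfolding h_def[abs_def] using linear_coords[OF linear_id, of y] by simp
  have inj: "inj h" unfolding h_def[abs_def] by (rule inj_coords[OF sp])
  have dim: "dim (range h) = 3"
    using dim_image_eq[OF lh, of UNIV] inj by simp
  have "range h = A3_space"
  proof (rule subspace_dim_equal)
    show "subspace (range h)" by (rule linear_subspace_image[OF lh subspace_UNIV])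
    show "range h \<subseteq> A3_space" using hA by blast
    show "dim A3_space \<le> dim (range h)" by (simp only: dim dim_A3_space)
  qed (rule subspace_A3_space)
  then have "bij_betw h UNIV A3_space" using inj by (simp add: bij_betw_def)
  then have bij: "bij_betw (\<lambda>x. h (g x)) UNIV A3_space" by (rule bij_betw_precompose[OF g(2)])
  have key: "\<exists>i j. i \<noteq> j \<and> (\<forall>u. h (elem_proj v \<phi> u) = h u - h u $ i *\<^sub>R (axis i 1 - axis j 1))"
    if \<phi>: "\<phi> \<in> \<Phi>" and v: "v \<in> V" and nz: "\<phi> \<bullet> v \<noteq> 0" for \<phi> v
  proof -
    obtain i c where i: "c \<noteq> 0" "\<phi> = c *\<^sub>R y i" using y\<Phi>[OF \<phi>] by blast
    with nz have yi: "y i \<bullet> v \<noteq> 0" by simp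
    obtain j where j: "j \<noteq> i" "\<And>k. k \<noteq> i \<Longrightarrow> k \<noteq> j \<Longrightarrow> y k \<bullet> v = 0"
      using yV[OF v] yi by metis
    \<comment> \<open>The coordinates of v sum to zero and only two of them can be nonzero, so these
      two are opposite.\<close>
    have "(\<Sum>k\<in>UNIV. y k \<bullet> v) = 0" unfolding inner_sum_left[symmetric] y0 by simp
    moreover have "(\<Sum>k\<in>UNIV. y k \<bullet> v) = (\<Sum>k\<in>{i, j}. y k \<bullet> v)"
      using j(2) by (intro sum.mono_neutral_right) auto
    ultimately have yj: "y j \<bullet> v = - (y i \<bullet> v)" using j(1) by simp
    have "h (elem_proj v \<phi> u) = h u - h u $ i *\<^sub>R (axis i 1 - axis j 1)" for u
    proof -
      have "y k \<bullet> elem_proj v \<phi> u = y k \<bullet> u - (y i \<bullet> u) * ((axis i 1 - axis j 1 :: real ^ 4) $ k)" for k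
      proof -
        have "y k \<bullet> elem_proj v \<phi> u = y k \<bullet> u - (y i \<bullet> u) / (y i \<bullet> v) * (y k \<bullet> v)"
          using i(1) by (simp add: i(2) elem_proj_def inner_diff_right)
        moreover have "y k \<bullet> v = (y i \<bullet> v) * ((axis i 1 - axis j 1 :: real ^ 4) $ k)"
        proof (cases "k = i \<or> k = j")
          case True
          then show ?thesis using yj j(1) by (elim disjE) (simp_all add: axis_def)
        next
          case False
          then show ?thesis using j(2)[of k] by (simp add: axis_def)
        qed
        ultimately show ?thesis using yi by simp
      qed
      then show ?thesis by (simp add: h_def vec_eq_iff)
    qed
    then show ?thesis using j(1) by (intro exI[of _ i] exI[of _ j] conjI allI) simp_all
  qed
  show ?thesis
    unfolding A3_monoid_def
  proof (rule equivalent_to_generated_monoid[OF _ bij subspace_A3_space])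
    show "linear (\<lambda>x. h (g x))" unfolding h_def by (rule linear_coords[OF g(1)])
    show "A3_generators \<subseteq> carrier (End_monoid A3_space)"
      by (auto simp: A3_generators_def projection_along_def is_projection_def)
    fix r assume "r \<in> R"
    then obtain \<phi> v where pv: "\<phi> \<in> \<Phi>" "v \<in> V" "\<phi> \<bullet> v \<noteq> 0"
      and r: "\<forall>x. g (r x) = elem_proj v \<phi> (g x)"
      using R by metis
    obtain i j where ij: "i \<noteq> j"
      "\<forall>u. h (elem_proj v \<phi> u) = h u - h u $ i *\<^sub>R (axis i 1 - axis j 1)"
      using key[OF pv] by metis
    show "\<exists>q\<in>A3_generators. \<forall>x. q (h (g x)) = h (g (r x))"
      using A3_generator[OF ij(1)] by (rule bexI[rotated]) (simp add: r ij(2) hA)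
  qed
qed

lemma signed_frame_B32:
  fixes g :: "'e::real_vector \<Rightarrow> real ^ 3"
  assumes g: "linear g" "bij g" and y: "signed_frame \<Phi> V y"
    and vals: "\<And>\<phi> v. \<phi> \<in> \<Phi> \<Longrightarrow> v \<in> V \<Longrightarrow> \<phi> \<bullet> v \<in> {-1, 0, 1}"
    and R: "\<And>r. r \<in> R \<Longrightarrow> \<exists>\<phi>\<in>\<Phi>. \<exists>v\<in>V. \<phi> \<bullet> v \<noteq> 0 \<and> (\<forall>x. g (r x) = elem_proj v \<phi> (g x))"
  shows "equivalent_to_submonoid UNIV (generated_monoid UNIV R) UNIV B32_monoid"
proof -
  define h where "h u = (\<chi> i. y i \<bullet> u)" for u
  have sp: "span (range y) = UNIV" and yin: "\<And>i. y i \<in> \<Phi>"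
    and y\<Phi>: "\<phi> \<in> \<Phi> \<Longrightarrow> \<exists>i. par \<phi> (y i)" and yV: "v \<in> V \<Longrightarrow> \<exists>i. y i \<bullet> v = 0" for \<phi> v
    using y unfolding signed_frame_def by blast+
  have lh: "linear h" unfolding h_def[abs_def] using linear_coords[OF linear_id, of y] by simp
  have inj: "inj h" unfolding h_def[abs_def] by (rule inj_coords[OF sp])
  have "surj h" by (rule linear_inj_imp_surj[OF lh inj])
  then have "bij h" using inj by (simp add: bij_def)
  then have bij: "bij_betw (\<lambda>x. h (g x)) UNIV UNIV" by (rule bij_betw_precompose[OF g(2)])
  have key: "\<exists>i j. \<exists>s\<in>{0, 1, -1}. i \<noteq> j \<and>
      (\<forall>u. h (elem_proj v \<phi> u) = h u - h u $ i *\<^sub>R (axis i 1 - s *\<^sub>R axis j 1))"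
    if \<phi>: "\<phi> \<in> \<Phi>" and v: "v \<in> V" and nz: "\<phi> \<bullet> v \<noteq> 0" for \<phi> v
  proof -
    obtain i where "par \<phi> (y i)" using y\<Phi>[OF \<phi>] by blast
    then obtain c :: real where i: "c \<noteq> 0" "\<phi> = c *\<^sub>R y i"
      unfolding par_def by (metis scaleR_minus_left scaleR_one zero_neq_neg_one zero_neq_one)
    with nz have yi: "y i \<bullet> v \<noteq> 0" by simp
    obtain l where l: "y l \<bullet> v = 0" using yV[OF v] by blast
    then have li: "l \<noteq> i" using yi by auto
    obtain j where j: "j \<noteq> i" "j \<noteq> l"
    proof -
      have "{i, l} \<noteq> UNIV"
      proof
        assume "{i, l} = UNIV"
        then have "card {i, l} = 3" by simp
        then show False using li by simp
      qed
      then show ?thesis using that by blast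
    qed
    have ex: "k = i \<or> k = j \<or> k = l" for k
      using exhaust_3[of i] exhaust_3[of j] exhaust_3[of k] exhaust_3[of l] j li by auto
    \<comment> \<open>Makes the coordinate vector of v a multiple of
      \<open>axis i 1 - s *\<^sub>R axis j 1\<close>. As a ratio of entries it is 0, 1 or -1; the
      value 0 occurs when v meets only the vertex i.\<close>
    define s where "s = - ((y j \<bullet> v) / (y i \<bullet> v))"
    have s: "s \<in> {0, 1, -1}"
      using vals[OF yin v, of i] vals[OF yin v, of j] yi by (auto simp: s_def)
    have "h (elem_proj v \<phi> u) = h u - h u $ i *\<^sub>R (axis i 1 - s *\<^sub>R axis j 1)" for u
    proof -
      have "y k \<bullet> elem_proj v \<phi> u = y k \<bullet> u - (y i \<bullet> u) * ((axis i 1 - s *\<^sub>R axis j 1 :: real ^ 3) $ k)" for k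
      proof -
        have "y k \<bullet> elem_proj v \<phi> u = y k \<bullet> u - (y i \<bullet> u) / (y i \<bullet> v) * (y k \<bullet> v)"
          using i(1) by (simp add: i(2) elem_proj_def inner_diff_right)
        moreover have "y k \<bullet> v = (y i \<bullet> v) * ((axis i 1 - s *\<^sub>R axis j 1 :: real ^ 3) $ k)"
          using ex[of k] yi l j li by (elim disjE) (simp_all add: axis_def s_def)
        ultimately show ?thesis using yi by simp
      qed
      then show ?thesis by (simp add: h_def vec_eq_iff)
    qed
    then show ?thesis
      using j(1) s by (intro exI[of _ i] exI[of _ j] bexI[of _ s] conjI allI) simp_all
  qed
  show ?thesis
    unfolding B32_monoid_def
  proof (rule equivalent_to_generated_monoid[OF _ bij subspace_UNIV])
    show "linear (\<lambda>x. h (g x))" unfolding h_def by (rule linear_coords[OF g(1)])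
    show "B32_generators \<subseteq> carrier (End_monoid UNIV)"
      by (auto simp: B32_generators_def projection_along_def is_projection_def)
    fix r assume "r \<in> R"
    then obtain \<phi> v where pv: "\<phi> \<in> \<Phi>" "v \<in> V" "\<phi> \<bullet> v \<noteq> 0"
      and r: "\<forall>x. g (r x) = elem_proj v \<phi> (g x)"
      using R by metis
    obtain i j s where ijs: "i \<noteq> j" "s \<in> {0, 1, -1}"
      "\<forall>u. h (elem_proj v \<phi> u) = h u - h u $ i *\<^sub>R (axis i 1 - s *\<^sub>R axis j 1)"
      using key[OF pv] by metis
    show "\<exists>q\<in>B32_generators. \<forall>x. q (h (g x)) = h (g (r x))"
      using B32_generator[OF ijs(1,2)] by (rule bexI[rotated]) (simp add: r ijs(3))
  qed
qed

section \<open>Duality\<close>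

definition functional_vec :: "((real ^ 3) \<Rightarrow>\<^sub>L real) \<Rightarrow> real ^ 3" where
  "functional_vec \<psi> = (\<chi> i. blinfun_apply \<psi> (axis i 1))"

lemma functional_vec_inner: "functional_vec \<psi> \<bullet> x = blinfun_apply \<psi> x"
proof -
  have "blinfun_apply \<psi> x = blinfun_apply \<psi> (\<Sum>k\<in>UNIV. x $ k *\<^sub>R axis k 1)"
    by (simp only: vec_expansion[of x, symmetric])
  also have "\<dots> = functional_vec \<psi> \<bullet> x"
    by (simp add: blinfun.sum_right blinfun.scaleR_right functional_vec_def inner_vec_def mult.commute)
  finally show ?thesis by simp
qed

lemma linear_functional_vec: "linear functional_vec"
  by (rule linearI) (simp_all add: functional_vec_def vec_eq_iff blinfun.add_left blinfun.scaleR_left)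

lemma bij_functional_vec: "bij functional_vec"
proof (rule bijI)
  show "inj functional_vec"
    by (rule injI) (metis functional_vec_inner blinfun_eqI)
  have "functional_vec (Blinfun (\<lambda>x. w \<bullet> x)) = w" for w
    by (simp add: functional_vec_def bounded_linear_Blinfun_apply bounded_linear_inner_right vec_eq_iff inner_axis)
  then show "surj functional_vec" by (rule surjI)
qed

lemma dual_map_apply:
  assumes "linear m"
  shows "blinfun_apply (dual_map m \<psi>) x = blinfun_apply \<psi> (m x)"
proof -
  have "bounded_linear (\<lambda>x. blinfun_apply \<psi> (m x))"
    using assms by (intro bounded_linear_compose[OF blinfun.bounded_linear_right])
      (simp add: linear_conv_bounded_linear)
  then show ?thesis by (simp add: dual_map_def bounded_linear_Blinfun_apply)
qed

text \<open>Transposition exchanges the kernel vector and the functional, so the dual monoid belongs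
  to the transposed matrix.\<close>

lemma dual_map_elem_proj:
  "functional_vec (dual_map (elem_proj w \<theta>) \<psi>) = elem_proj \<theta> w (functional_vec \<psi>)"
proof -
  have "functional_vec (dual_map (elem_proj w \<theta>) \<psi>) \<bullet> x = elem_proj \<theta> w (functional_vec \<psi>) \<bullet> x" for x
    unfolding functional_vec_inner dual_map_apply[OF linear_elem_proj]
    unfolding functional_vec_inner[symmetric]
    by (simp add: elem_proj_def inner_diff_right inner_diff_left inner_commute)
  then show ?thesis by (rule vector_eq_rdot[THEN iffD1, OF allI])
qed

text \<open>Dualising reverses products, but closure under products is symmetric in the two
  factors.\<close>

lemma dual_monoid_generated:
  assumes R: "\<And>r. r \<in> R \<Longrightarrow> linear r"
  shows "dual_monoid (generated_monoid UNIV R) = generated_monoid UNIV (dual_map ` R)"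
proof -
  have id: "dual_map id = id"
    by (rule ext, rule blinfun_eqI) (simp add: dual_map_apply linear_id)
  have comp: "dual_map (m \<circ> n) = dual_map n \<circ> dual_map m" if "linear m" "linear n" for m n
    by (rule ext, rule blinfun_eqI) (simp add: dual_map_apply that linear_compose)
  have "dual_map m \<in> generated_monoid UNIV (dual_map ` R)" if "m \<in> generated_monoid UNIV R" for m
    using that
  proof induction
    case one
    then show ?case using generated_monoid.one[of UNIV "dual_map ` R"] by (simp only: End_UNIV_simps id)
  next
    case (gen r)
    then show ?case by (intro generated_monoid.gen) blast
  next
    case (mult m n)
    then have "linear m" "linear n" using generated_monoid_linear R by blast+
    then show ?case using generated_monoid.mult[OF mult.IH(2,1)] by (simp only: End_UNIV_simps comp)
  qed
  moreover have "m \<in> dual_map ` generated_monoid UNIV R" if "m \<in> generated_monoid UNIV (dual_map ` R)" for m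
    using that
  proof induction
    case one
    then show ?case using generated_monoid.one[of UNIV R] unfolding End_UNIV_simps by (metis id image_eqI)
  next
    case (gen r)
    then show ?case using generated_monoid.gen by blast
  next
    case (mult m n)
    then obtain m' n' where *: "m = dual_map m'" "n = dual_map n'"
      and mem: "m' \<in> generated_monoid UNIV R" "n' \<in> generated_monoid UNIV R" by blast
    then have "linear m'" "linear n'" using generated_monoid_linear R by blast+
    then have "m \<otimes>\<^bsub>End_monoid UNIV\<^esub> n = dual_map (n' \<circ> m')"
      by (simp only: End_UNIV_simps comp *)
    moreover have "n' \<circ> m' \<in> generated_monoid UNIV R"
      using generated_monoid.mult[OF mem(2,1)] by (simp only: End_UNIV_simps)
    ultimately show ?case by blast
  qed
  ultimately show ?thesis unfolding dual_monoid_def by blast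
qed

section \<open>The classification\<close>

lemma projection_elem_proj:
  fixes p :: "real ^ 3 \<Rightarrow> real ^ 3"
  assumes "is_projection UNIV p"
  obtains w \<theta> where "\<theta> \<bullet> w = 1" "p = elem_proj w \<theta>"
proof -
  have lin: "linear p" and idem: "p \<circ> p = p" and dim: "dim {x. p x = 0} = 1"
    using assms by (auto simp: is_projection_def carrier_End_UNIV compose_UNIV kernel_on_def)
  obtain B where B: "B \<subseteq> {x. p x = 0}" "independent B" "{x. p x = 0} \<subseteq> span B" "card B = dim {x. p x = 0}"
    using basis_exists[of "{x. p x = 0}"] by blast
  then obtain w where w: "B = {w}" using dim by (metis card_1_singletonE)
  have w0: "w \<noteq> 0" using B(2) w by (metis dependent_zero insertI1)
  have pw: "p w = 0" using B(1) w by blast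
  define q where "q x = x - p x" for x
  have lq: "linear q" unfolding q_def[abs_def] using lin linear_id linear_compose_sub[of "\<lambda>x. x" p] by (simp add: id_def)
  have qs: "\<exists>c. q x = c *\<^sub>R w" for x
  proof -
    have "p (q x) = 0" using fun_cong[OF idem, of x] by (simp add: q_def linear_diff[OF lin])
    then show ?thesis using B(3) w by (auto simp: span_singleton)
  qed
  \<comment> \<open>The vector representing the coefficient of \<open>q x\<close> along w; the
    adjoint moves q to the other side of the inner product.\<close>
  define \<theta> where "\<theta> = (1 / (w \<bullet> w)) *\<^sub>R adjoint q w"
  have \<theta>: "\<theta> \<bullet> x = (q x \<bullet> w) / (w \<bullet> w)" for x
    using adjoint_works[OF lq, of x w] by (simp add: \<theta>_def inner_commute)
  have qx: "q x = (\<theta> \<bullet> x) *\<^sub>R w" for x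
  proof -
    obtain c where "q x = c *\<^sub>R w" using qs by blast
    then show ?thesis using w0 by (simp add: \<theta>)
  qed
  have "\<theta> \<bullet> w = 1" using w0 by (simp add: \<theta>) (simp add: q_def pw)
  moreover have "p x = elem_proj w \<theta> x" for x
    using qx[of x] \<open>\<theta> \<bullet> w = 1\<close> by (simp add: elem_proj_def q_def algebra_simps)
  ultimately show ?thesis using that by blast
qed

theorem theorem5p1:
  fixes M :: "(real ^ 3 \<Rightarrow> real ^ 3) set"
  assumes "projection_monoid UNIV M"
    and "finite M"
    and "irreducible_monoid UNIV M"
  shows "equivalent_to_submonoid UNIV M A3_space A3_monoid \<or>
         equivalent_to_submonoid UNIV M UNIV B32_monoid \<or>
         equivalent_to_submonoid UNIV (dual_monoid M) A3_space A3_monoid \<or>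
         equivalent_to_submonoid UNIV (dual_monoid M) UNIV B32_monoid"
proof -
  obtain R where R: "\<And>r. r \<in> R \<Longrightarrow> is_projection UNIV r" and M: "M = generated_monoid UNIV R"
    using assms(1) unfolding projection_monoid_def by blast
  have linR: "linear r" if "r \<in> R" for r
    using R[OF that] by (simp add: is_projection_def carrier_End_UNIV)
  define P where "P = {(w, \<theta>). \<theta> \<bullet> w = 1 \<and> elem_proj w \<theta> \<in> R}"
  have RP: "\<exists>w \<theta>. (w, \<theta>) \<in> P \<and> r = elem_proj w \<theta>" if "r \<in> R" for r
    using projection_elem_proj[OF R[OF that]] that unfolding P_def by blast
  interpret finite_projections M P
  proof (rule finite_projections.intro)
    show "finite M" by fact
    show "linear m" if "m \<in> M" for m using that generated_monoid_linear linR unfolding M by blast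
    show "m \<circ> n \<in> M" if "m \<in> M" "n \<in> M" for m n
      using generated_monoid.mult[of m UNIV R n] that unfolding M End_UNIV_simps by blast
    show "\<theta> \<bullet> w = 1" "elem_proj w \<theta> \<in> M" if "(w, \<theta>) \<in> P" for w \<theta>
      using that by (auto simp: P_def M intro: generated_monoid.gen)
    fix W :: "(real ^ 3) set"
    assume W: "subspace W" and PW: "\<And>w \<theta>. (w, \<theta>) \<in> P \<Longrightarrow> w \<in> W \<or> (\<forall>x\<in>W. \<theta> \<bullet> x = 0)"
    have inv: "r x \<in> W" if "r \<in> R" "x \<in> W" for r x
    proof -
      obtain w \<theta> where "(w, \<theta>) \<in> P" "r = elem_proj w \<theta>" using RP \<open>r \<in> R\<close> by blast
      then show ?thesis using PW[of w \<theta>] W \<open>x \<in> W\<close>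
        by (auto simp: elem_proj_fixes) (auto simp: elem_proj_def subspace_diff subspace_scale)
    qed
    have "\<forall>x\<in>W. m x \<in> W" if "m \<in> M" for m
      using that unfolding M
      by (induction rule: generated_monoid.induct) (auto simp: End_UNIV_simps inv)
    then have "\<forall>m\<in>M. m ` W \<subseteq> W" by (simp add: image_subset_iff)
    then have "\<not> ({0} \<subset> W \<and> W \<subset> UNIV)"
      using assms(3) W unfolding irreducible_monoid_def by metis
    moreover have "{0} \<subseteq> W" using subspace_0[OF W] by simp
    ultimately show "W = {0} \<or> W = UNIV" by (metis psubsetI subset_UNIV)
  qed
  \<comment> \<open>A base pair is needed for the normalisation. Without any projection every line
    would be invariant, which dimension three forbids.\<close>
  have "P \<noteq> {}"
  proof
    assume "P = {}"
    then have "span {axis 1 1 :: real ^ 3} = {0} \<or> span {axis 1 1 :: real ^ 3} = UNIV"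
      by (intro irreducible subspace_span) blast
    moreover have d: "dim (span {axis 1 1 :: real ^ 3}) = 1" by (simp add: dim_span axis_eq_0_iff)
    ultimately have "dim ({0} :: (real ^ 3) set) = 1 \<or> dim (UNIV :: (real ^ 3) set) = 1"
      by (elim disjE) (simp_all only: simp_thms)
    then show False by simp
  qed
  then obtain a \<alpha> where "(a, \<alpha>) \<in> P" by auto
  then interpret based_projections M P a \<alpha> by unfold_locales
  have rep: "\<exists>\<phi>\<in>\<Phi>. \<exists>v\<in>V. \<phi> \<bullet> v \<noteq> 0 \<and> r = elem_proj v \<phi>" if r: "r \<in> R" for r
  proof -
    obtain w \<theta> where P: "(w, \<theta>) \<in> P" "r = elem_proj w \<theta>" using RP[OF r] by blast
    obtain c d where cd: "c \<noteq> 0" "d \<noteq> 0" "c *\<^sub>R \<theta> \<in> \<Phi>" "d *\<^sub>R w \<in> V" by (rule generator_scaled[OF P(1)])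
    have "elem_proj (d *\<^sub>R w) (c *\<^sub>R \<theta>) = r" using elem_proj_scale cd P(2) by simp
    moreover have "(c *\<^sub>R \<theta>) \<bullet> (d *\<^sub>R w) \<noteq> 0" using cd unit[OF P(1)] by simp
    ultimately show ?thesis using cd(3,4) by metis
  qed
  have primal: "\<exists>\<phi>\<in>\<Phi>. \<exists>v\<in>V. \<phi> \<bullet> v \<noteq> 0 \<and> (\<forall>x. id (r x) = elem_proj v \<phi> (id x))" if "r \<in> R" for r
    using rep[OF that] by auto
  have dual: "\<exists>v\<in>V. \<exists>\<phi>\<in>\<Phi>. v \<bullet> \<phi> \<noteq> 0 \<and> (\<forall>\<psi>. functional_vec (s \<psi>) = elem_proj \<phi> v (functional_vec \<psi>))"
    if s: "s \<in> dual_map ` R" for s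
  proof -
    obtain r where r: "r \<in> R" "s = dual_map r" using s by blast
    obtain \<phi> v where "\<phi> \<in> \<Phi>" "v \<in> V" "\<phi> \<bullet> v \<noteq> 0" "r = elem_proj v \<phi>" using rep[OF r(1)] by blast
    then show ?thesis using r(2) dual_map_elem_proj by (metis inner_commute)
  qed
  have dM: "dual_monoid M = generated_monoid UNIV (dual_map ` R)"
    unfolding M by (rule dual_monoid_generated[OF linR])
  from config.thin_either show ?thesis
  proof
    assume "thin \<Phi> V"
    from config.thin_frame[OF this] show ?thesis
    proof (elim disjE exE)
      fix y assume "balanced_frame \<Phi> V y"
      from balanced_frame_A3[OF linear_id bij_id this primal] show ?thesis unfolding M by blast
    next
      fix y assume "signed_frame \<Phi> V y"
      from signed_frame_B32[OF linear_id bij_id this vals primal] show ?thesis unfolding M by blast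
    qed
  next
    interpret opp: dual_config V \<Phi> by (rule config.flip)
    assume "thin V \<Phi>"
    from opp.thin_frame[OF this] show ?thesis
    proof (elim disjE exE)
      fix y assume "balanced_frame V \<Phi> y"
      from balanced_frame_A3[OF linear_functional_vec bij_functional_vec this dual]
      show ?thesis unfolding dM by blast
    next
      fix y assume "signed_frame V \<Phi> y"
      from signed_frame_B32[OF linear_functional_vec bij_functional_vec this opp.vals dual]
      show ?thesis unfolding dM by blast
    qed
  qed
qed

end
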